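(* Let the point-shift $\mathfrak H$ be bijective. Then $\mathfrak h^{-1}$ and $\mathfrak h^-$ have the same law under $\mathbf P^{\mathfrak m}$ if and only if $\mathfrak H$ is isomodular.
   Context: $\mathbb X$ is a locally compact second-countable Hausdorff topological group (not necessarily unimodular) with neutral element $e$, Borel sets $\mathcal B(\mathbb X)$, a fixed left-invariant Haar measure $\lambda$, and modular function $\Delta:\mathbb X\to(0,\infty)$ given by $\lambda(Bx)=\Delta(x)\lambda(B)$ for all $B\in\mathcal B(\mathbb X)$. $(\Omega,\mathcal A,\theta,\mathbf P)$ is a stationary framework on $\mathbb X$: $(\Omega,\mathcal A,\mathbf P)$ is a probability space and $\theta:\mathbb X\times\Omega\to\Omega$, $\theta_x\omega:=\theta(x,\omega)$, is a (jointly) measurable left action of $\mathbb X$ preserving $\mathbf P$. $\mathfrak m$ is a simple point process (random locally finite counting measure on $\mathbb X$ with all atoms of mass $1$, identified with its support) that is flow-adapted: $\mathfrak m(\theta_x\omega,B)=\mathfrak m(\omega,x^{-1}B)$ for all $x\in\mathbb X,\omega\in\Omega,B\in\mathcal B(\mathbb X)$; its intensity $\gamma=\mathbf E[\mathfrak m(B)]/\lambda(B)$ (for any $B$ with $\lambda(B)\in(0,\infty)$) lies in $(0,\infty)$. The Palm probability measure is $\mathbf P^{\mathfrak m}(A):=\frac1\gamma\mathbf E\int_{\mathbb X}1_{\theta_x^{-1}\omega\in A}w(x)\,\mathfrak m(dx)$, for any measurable $w:\mathbb X\to[0,\infty)$ with $\int w\,d\lambda=1$. $\mathfrak H$ is a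 point-shift on $\mathfrak m$: a measurable map $\mathfrak H:\Omega\times\mathbb X\to\mathbb X$ such that for $\mathbf P$-a.e. $\omega$, $\mathfrak H(\omega,X)\in\mathfrak m(\omega)$ for all $X\in\mathfrak m(\omega)$, which is flow-adapted: $\mathfrak H(\theta_y\omega,yx)=y\mathfrak H(\omega,x)$ for all $x,y\in\mathbb X$, $\omega\in\Omega$ (with $\mathfrak H(\omega,x):=x$ for $x\notin\mathfrak m(\omega)$). $\mathfrak H$ is bijective if for $\mathbf P$-a.e. $\omega$, $\mathfrak H(\omega,\cdot)$ is a bijection of the support of $\mathfrak m(\omega)$. $\mathfrak H$ is isomodular if $\mathbf P$-a.s. $\Delta(X)=\Delta(\mathfrak H(X))$ for all $X\in\mathfrak m$. The point-map of $\mathfrak H$ is $\mathfrak h(\omega):=\mathfrak H(\omega,e)$, and $\mathfrak h^{-1}$ is its reciprocal, i.e. the group inverse $\omega\mapsto\mathfrak h(\omega)^{-1}\in\mathbb X$. For bijective $\mathfrak H$, $\mathfrak h^-$ is defined $\mathbf P^{\mathfrak m}$-a.s. as the unique $Y\in\mathfrak m$ with $\mathfrak H(Y)=e$. *)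

theory Defs
  imports "HOL-Probability.Probability"
begin

(* The group is written additively: topological_group_add is the topological group class of
   the library and does not require commutativity. So 0 is the neutral element e, x + y is the
   product xy, - x is the group inverse of x, and order matters in every sum below. *)

(* On a locally compact second-countable Hausdorff space a Borel measure that is finite on
   compact sets is automatically regular, so regularity is not listed. *)
definition left_haar_measure :: "'x::topological_group_add measure \<Rightarrow> bool" where
  "left_haar_measure L \<longleftrightarrow>
     sets L = sets borel \<and>
     (\<forall>K. compact K \<longrightarrow> emeasure L K < \<infinity>) \<and>
     emeasure L UNIV \<noteq> 0 \<and>
     (\<forall>x. \<forall>B\<in>sets borel. emeasure L ((\<lambda>b. x + b) ` B) = emeasure L B)"

definition is_modular_function :: "'x::topological_group_add measure \<Rightarrow> ('x \<Rightarrow> real) \<Rightarrow> bool" where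
  "is_modular_function L \<Delta> \<longleftrightarrow>
     (\<forall>x. 0 < \<Delta> x) \<and>
     (\<forall>x. \<forall>B\<in>sets borel. emeasure L ((\<lambda>b. b + x) ` B) = ennreal (\<Delta> x) * emeasure L B)"

locale stationary_framework = prob_space P
  for P :: "'w measure" and \<theta> :: "'x::topological_group_add \<Rightarrow> 'w \<Rightarrow> 'w" +
  assumes flow_measurable: "(\<lambda>(x, \<omega>). \<theta> x \<omega>) \<in> borel \<Otimes>\<^sub>M P \<rightarrow>\<^sub>M P"
    and flow_zero: "\<omega> \<in> space P \<Longrightarrow> \<theta> 0 \<omega> = \<omega>"
    and flow_add: "\<omega> \<in> space P \<Longrightarrow> \<theta> (x + y) \<omega> = \<theta> x (\<theta> y \<omega>)"
    and flow_preserves: "distr P P (\<theta> x) = P"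

definition locally_finite_counting_measure :: "'x::topological_space measure \<Rightarrow> bool" where
  "locally_finite_counting_measure \<mu> \<longleftrightarrow>
     sets \<mu> = sets borel \<and>
     (\<forall>K. compact K \<longrightarrow> emeasure \<mu> K < \<infinity>) \<and>
     (\<forall>B\<in>sets borel. emeasure \<mu> B = \<infinity> \<or> (\<exists>n::nat. emeasure \<mu> B = of_nat n))"

definition simple_point_process :: "'w measure \<Rightarrow> ('w \<Rightarrow> 'x::topological_space measure) \<Rightarrow> bool" where
  "simple_point_process P m \<longleftrightarrow>
     (\<forall>\<omega>\<in>space P. locally_finite_counting_measure (m \<omega>) \<and> (\<forall>x. emeasure (m \<omega>) {x} \<in> {0, 1})) \<and>
     (\<forall>B\<in>sets borel. (\<lambda>\<omega>. emeasure (m \<omega>) B) \<in> borel_measurable P)"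

(* The support of a locally finite counting measure is its set of atoms. *)
definition points :: "'x measure \<Rightarrow> 'x set" where
  "points \<mu> = {x. emeasure \<mu> {x} \<noteq> 0}"

definition flow_adapted ::
    "'w measure \<Rightarrow> ('x::topological_group_add \<Rightarrow> 'w \<Rightarrow> 'w) \<Rightarrow> ('w \<Rightarrow> 'x measure) \<Rightarrow> bool" where
  "flow_adapted P \<theta> m \<longleftrightarrow>
     (\<forall>x. \<forall>\<omega>\<in>space P. \<forall>B\<in>sets borel.
        emeasure (m (\<theta> x \<omega>)) B = emeasure (m \<omega>) ((\<lambda>b. - x + b) ` B))"

definition has_intensity ::
    "'x::topological_space measure \<Rightarrow> 'w measure \<Rightarrow> ('w \<Rightarrow> 'x measure) \<Rightarrow> real \<Rightarrow> bool" where
  "has_intensity L P m \<gamma> \<longleftrightarrow>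
     (\<forall>B\<in>sets borel. 0 < emeasure L B \<and> emeasure L B < \<infinity> \<longrightarrow>
        (\<integral>\<^sup>+\<omega>. emeasure (m \<omega>) B \<partial>P) / emeasure L B = ennreal \<gamma>)"

(* The weight w is any nonnegative measurable function of integral 1 with respect to Haar
   measure; the result does not depend on it. For an action, the inverse of \<theta> x is \<theta> (- x). *)
definition palm_measure ::
    "'w measure \<Rightarrow> ('x::topological_group_add \<Rightarrow> 'w \<Rightarrow> 'w) \<Rightarrow> ('w \<Rightarrow> 'x measure) \<Rightarrow>
     real \<Rightarrow> ('x \<Rightarrow> real) \<Rightarrow> 'w measure" where
  "palm_measure P \<theta> m \<gamma> w =
     measure_of (space P) (sets P)
       (\<lambda>A. ennreal (1 / \<gamma>) *
          (\<integral>\<^sup>+\<omega>. (\<integral>\<^sup>+x. indicator A (\<theta> (- x) \<omega>) * ennreal (w x) \<partial>m \<omega>) \<partial>P))"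

definition point_shift ::
    "'w measure \<Rightarrow> ('x::topological_group_add \<Rightarrow> 'w \<Rightarrow> 'w) \<Rightarrow> ('w \<Rightarrow> 'x measure) \<Rightarrow>
     ('w \<Rightarrow> 'x \<Rightarrow> 'x) \<Rightarrow> bool" where
  "point_shift P \<theta> m H \<longleftrightarrow>
     (\<lambda>(\<omega>, x). H \<omega> x) \<in> P \<Otimes>\<^sub>M borel \<rightarrow>\<^sub>M borel \<and>
     (AE \<omega> in P. \<forall>X\<in>points (m \<omega>). H \<omega> X \<in> points (m \<omega>)) \<and>
     (\<forall>\<omega>\<in>space P. \<forall>x y. H (\<theta> y \<omega>) (y + x) = y + H \<omega> x) \<and>
     (\<forall>\<omega>\<in>space P. \<forall>x. x \<notin> points (m \<omega>) \<longrightarrow> H \<omega> x = x)"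

definition bijective_shift ::
    "'w measure \<Rightarrow> ('w \<Rightarrow> 'x measure) \<Rightarrow> ('w \<Rightarrow> 'x \<Rightarrow> 'x) \<Rightarrow> bool" where
  "bijective_shift P m H \<longleftrightarrow> (AE \<omega> in P. bij_betw (H \<omega>) (points (m \<omega>)) (points (m \<omega>)))"

definition isomodular ::
    "'w measure \<Rightarrow> ('w \<Rightarrow> 'x measure) \<Rightarrow> ('x \<Rightarrow> real) \<Rightarrow> ('w \<Rightarrow> 'x \<Rightarrow> 'x) \<Rightarrow> bool" where
  "isomodular P m \<Delta> H \<longleftrightarrow> (AE \<omega> in P. \<forall>X\<in>points (m \<omega>). \<Delta> X = \<Delta> (H \<omega> X))"

definition point_map :: "('w \<Rightarrow> 'x::topological_group_add \<Rightarrow> 'x) \<Rightarrow> 'w \<Rightarrow> 'x" where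
  "point_map H \<omega> = H \<omega> 0"

(* The value 0 is a convention for those \<omega>, Palm-null when H is bijective, at which there is
   no unique preimage of 0. A bare THE could fail to be measurable there. *)
definition point_map_minus ::
    "('w \<Rightarrow> 'x::topological_group_add measure) \<Rightarrow> ('w \<Rightarrow> 'x \<Rightarrow> 'x) \<Rightarrow> 'w \<Rightarrow> 'x" where
  "point_map_minus m H \<omega> =
     (if \<exists>!Y. Y \<in> points (m \<omega>) \<and> H \<omega> Y = 0
      then (THE Y. Y \<in> points (m \<omega>) \<and> H \<omega> Y = 0) else 0)"

end

theory Submission
  imports Defs
begin

text \<open>
  Let \<open>h\<close> be the point-map, and \<open>h'\<close> the map that locates the preimage of the origin. The proof
  rests on one identity: under the Palm measure, the law of \<open>h'\<close> has density \<open>\<Delta>\<close> with respect to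
  the law of \<open>- h\<close> (lemma \<open>law_h'\<close>). This is mass transport. Count the points \<open>x\<close> of the process with
  weight \<open>w x\<close>, each marked by the position of its preimage relative to it. As the point-shift is a
  bijection, the sum may be reindexed by the preimages \<open>y\<close>; then the mark is minus the point-map seen
  from \<open>y\<close>, and the weight is \<open>w (y + h)\<close>. Integrating over the position \<open>y\<close> with respect to left
  Haar measure replaces the weight by \<open>\<Delta> (- h)\<close>, the price of a right translation.

  Given the identity, the two laws agree iff the density \<open>\<Delta>\<close> is one almost everywhere, that is, iff
  Palm-almost surely \<open>\<Delta> (- h) = 1\<close>. Since \<open>\<Delta>\<close> is a homomorphism, this says that the typical point \<open>x\<close>
  and its image have the same modulus, and a Palm-almost sure property of the typical point is an
  almost sure property of all points (lemma \<open>AE_modular_iff_isomodular\<close>).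

  Integrating over the position is legitimate because of the refined Campbell theorem
  (\<open>refined_campbell\<close>): the Campbell measure, which counts each point together with the realization
  as seen from it, is the product of Haar measure and \<open>\<gamma>\<close> times the Palm measure. It is invariant
  under left translation of the position by stationarity, so this is uniqueness of Haar measure
  (\<open>left_invariant_measure_unique\<close>), which follows directly from Tonelli's theorem here. Two facts
  enter from measure theory: integrals against the random counting measures depend measurably on the
  realization, and such a counting measure is carried by its atoms, so that a bijection of the
  atoms preserves it (\<open>distr_bij_points\<close>) and the preimage of the origin is measurable.
\<close>

section \<open>Measurability of kernels and their product measures\<close>

locale sigma_finite_kernel =
  fixes M :: "'a measure" and N :: "'b measure" and \<kappa> :: "'a \<Rightarrow> 'b measure" and K :: "nat \<Rightarrow> 'b set"
  assumes sets_kernel: "a \<in> space M \<Longrightarrow> sets (\<kappa> a) = sets N"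
    and kernel_measurable: "B \<in> sets N \<Longrightarrow> (\<lambda>a. emeasure (\<kappa> a) B) \<in> borel_measurable M"
    and K_sets: "K i \<in> sets N"
    and K_cover: "(\<Union>i. K i) = space N"
    and K_finite: "a \<in> space M \<Longrightarrow> emeasure (\<kappa> a) (K i) < \<infinity>"
begin

lemma space_kernel: "a \<in> space M \<Longrightarrow> space (\<kappa> a) = space N"
  using sets_kernel by (rule sets_eq_imp_space_eq)

lemma section_sets: "a \<in> space M \<Longrightarrow> A \<in> sets (M \<Otimes>\<^sub>M N) \<Longrightarrow> Pair a -` A \<in> sets (\<kappa> a)"
  using sets_kernel sets_Pair1 by metis

text \<open>Restricting to a piece \<^term>\<open>K i\<close> of finite mass is what allows the Dynkin argument: the
  complement step subtracts masses.\<close>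
lemma section_emeasure_measurable_piece:
  assumes "A \<in> sets (M \<Otimes>\<^sub>M N)"
  shows "(\<lambda>a. emeasure (\<kappa> a) (K i \<inter> Pair a -` A)) \<in> borel_measurable M"
  using Int_stable_pair_measure_generator pair_measure_closed assms unfolding sets_pair_measure
proof (induction A rule: sigma_sets_induct_disjoint)
  case (basic A)
  then obtain B C where [measurable]: "B \<in> sets M" "C \<in> sets N" and A: "A = B \<times> C" by auto
  have [measurable]: "(\<lambda>a. emeasure (\<kappa> a) (K i \<inter> C)) \<in> borel_measurable M"
    using K_sets by (intro kernel_measurable) auto
  have "(\<lambda>a. indicator B a * emeasure (\<kappa> a) (K i \<inter> C)) \<in> borel_measurable M"
    by measurable
  then show ?case
    by (rule measurable_cong[THEN iffD1, rotated]) (auto simp: A indicator_def)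
next
  case empty
  then show ?case by simp
next
  case (compl A)
  then have A: "A \<in> sets (M \<Otimes>\<^sub>M N)" by (simp add: sets_pair_measure)
  have "(\<lambda>a. emeasure (\<kappa> a) (K i) - emeasure (\<kappa> a) (K i \<inter> Pair a -` A)) \<in> borel_measurable M"
    using compl kernel_measurable[OF K_sets] by measurable
  then show ?case
  proof (rule measurable_cong[THEN iffD1, rotated])
    fix a assume a: "a \<in> space M"
    have "K i \<inter> Pair a -` (space M \<times> space N - A) = K i - (K i \<inter> Pair a -` A)"
      using a K_sets[of i, THEN sets.sets_into_space] by auto
    moreover have "emeasure (\<kappa> a) (K i - (K i \<inter> Pair a -` A))
        = emeasure (\<kappa> a) (K i) - emeasure (\<kappa> a) (K i \<inter> Pair a -` A)"
    proof (rule emeasure_Diff)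
      have "emeasure (\<kappa> a) (K i \<inter> Pair a -` A) \<le> emeasure (\<kappa> a) (K i)"
        using a K_sets sets_kernel by (intro emeasure_mono) auto
      then show "emeasure (\<kappa> a) (K i \<inter> Pair a -` A) \<noteq> \<infinity>"
        using K_finite[OF a, of i] by auto
    qed (use a A K_sets sets_kernel section_sets in auto)
    ultimately show "emeasure (\<kappa> a) (K i) - emeasure (\<kappa> a) (K i \<inter> Pair a -` A)
        = emeasure (\<kappa> a) (K i \<inter> Pair a -` (space M \<times> space N - A))" by simp
  qed
next
  case (union F)
  then have F: "F n \<in> sets (M \<Otimes>\<^sub>M N)" for n by (auto simp: sets_pair_measure)
  have "(\<lambda>a. \<Sum>n. emeasure (\<kappa> a) (K i \<inter> Pair a -` F n)) \<in> borel_measurable M"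
    using union by measurable
  then show ?case
  proof (rule measurable_cong[THEN iffD1, rotated])
    fix a assume a: "a \<in> space M"
    have "(\<Sum>n. emeasure (\<kappa> a) (K i \<inter> Pair a -` F n)) = emeasure (\<kappa> a) (\<Union>n. K i \<inter> Pair a -` F n)"
    proof (rule suminf_emeasure)
      show "range (\<lambda>n. K i \<inter> Pair a -` F n) \<subseteq> sets (\<kappa> a)"
        using a F K_sets sets_kernel section_sets by auto
      show "disjoint_family (\<lambda>n. K i \<inter> Pair a -` F n)"
        by (rule disjoint_family_on_bisimulation[OF union(1)]) auto
    qed
    also have "(\<Union>n. K i \<inter> Pair a -` F n) = K i \<inter> Pair a -` (\<Union>n. F n)" by auto
    finally show "(\<Sum>n. emeasure (\<kappa> a) (K i \<inter> Pair a -` F n))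
      = emeasure (\<kappa> a) (K i \<inter> Pair a -` (\<Union>n. F n))" .
  qed
qed

text \<open>A section is the disjoint union of its traces on the sets \<^term>\<open>disjointed K i\<close>, on each of which
  the previous lemma applies, because there all masses are finite.\<close>
lemma section_emeasure_measurable:
  assumes A: "A \<in> sets (M \<Otimes>\<^sub>M N)"
  shows "(\<lambda>a. emeasure (\<kappa> a) (Pair a -` A)) \<in> borel_measurable M"
proof -
  define D where "D = disjointed K"
  have D: "D i \<in> sets N" for i
    unfolding D_def using sets.range_disjointed_sets[of K N] K_sets by auto
  interpret D: sigma_finite_kernel M N \<kappa> D
  proof
    fix a i assume a: "a \<in> space M"
    have "emeasure (\<kappa> a) (D i) \<le> emeasure (\<kappa> a) (K i)"
      using disjointed_subset[of K i] sets_kernel[OF a] K_sets by (intro emeasure_mono) (auto simp: D_def)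
    also have "\<dots> < \<infinity>" by (rule K_finite[OF a])
    finally show "emeasure (\<kappa> a) (D i) < \<infinity>" .
  qed (simp_all add: sets_kernel kernel_measurable D, simp add: D_def UN_disjointed_eq K_cover)
  have "(\<lambda>a. \<Sum>i. emeasure (\<kappa> a) (D i \<inter> Pair a -` A)) \<in> borel_measurable M"
    using D.section_emeasure_measurable_piece[OF A] by measurable
  then show ?thesis
  proof (rule measurable_cong[THEN iffD1, rotated])
    fix a assume a: "a \<in> space M"
    have "(\<Sum>i. emeasure (\<kappa> a) (D i \<inter> Pair a -` A)) = emeasure (\<kappa> a) (\<Union>i. D i \<inter> Pair a -` A)"
    proof (rule suminf_emeasure)
      show "range (\<lambda>i. D i \<inter> Pair a -` A) \<subseteq> sets (\<kappa> a)"
        using a D A sets_kernel section_sets by auto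
      show "disjoint_family (\<lambda>i. D i \<inter> Pair a -` A)"
        by (rule disjoint_family_on_bisimulation[OF disjoint_family_disjointed[of K]]) (auto simp: D_def)
    qed
    also have "(\<Union>i. D i \<inter> Pair a -` A) = Pair a -` A"
      using sets.sets_into_space[OF A] D.K_cover by (auto simp: space_pair_measure)
    finally show "(\<Sum>i. emeasure (\<kappa> a) (D i \<inter> Pair a -` A)) = emeasure (\<kappa> a) (Pair a -` A)" .
  qed
qed

lemma section_measurable:
  "f \<in> borel_measurable (M \<Otimes>\<^sub>M N) \<Longrightarrow> a \<in> space M \<Longrightarrow> (\<lambda>b. f (a, b)) \<in> borel_measurable (\<kappa> a)"
  by (subst measurable_cong_sets[OF sets_kernel refl]) (auto intro: measurable_Pair2)

lemma nn_integral_section: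
  assumes "a \<in> space M" "A \<in> sets (M \<Otimes>\<^sub>M N)"
  shows "(\<integral>\<^sup>+b. indicator A (a, b) \<partial>\<kappa> a) = emeasure (\<kappa> a) (Pair a -` A)"
proof -
  have "(\<integral>\<^sup>+b. indicator A (a, b) \<partial>\<kappa> a) = (\<integral>\<^sup>+b. indicator (Pair a -` A) b \<partial>\<kappa> a)"
    by (intro nn_integral_cong) (simp split: split_indicator)
  then show ?thesis using section_sets[OF assms] by simp
qed

lemma nn_integral_kernel_measurable:
  fixes f :: "_ \<Rightarrow> ennreal"
  assumes "f \<in> borel_measurable (M \<Otimes>\<^sub>M N)"
  shows "(\<lambda>a. \<integral>\<^sup>+b. f (a, b) \<partial>\<kappa> a) \<in> borel_measurable M"
  using assms
proof induction
  case (cong f g)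
  show ?case
    using cong(4)
  proof (rule measurable_cong[THEN iffD1, rotated])
    fix a assume "a \<in> space M"
    then show "(\<integral>\<^sup>+b. g (a, b) \<partial>\<kappa> a) = (\<integral>\<^sup>+b. f (a, b) \<partial>\<kappa> a)"
      using cong by (intro nn_integral_cong) (auto simp: space_kernel space_pair_measure)
  qed
next
  case (set A)
  show ?case
    using section_emeasure_measurable[OF set]
    by (rule measurable_cong[THEN iffD1, rotated]) (simp add: nn_integral_section[OF _ set])
next
  case (mult u c)
  have "(\<integral>\<^sup>+b. c * u (a, b) \<partial>\<kappa> a) = c * (\<integral>\<^sup>+b. u (a, b) \<partial>\<kappa> a)" if "a \<in> space M" for a
    using mult that by (intro nn_integral_cmult section_measurable)
  moreover have "(\<lambda>a. c * (\<integral>\<^sup>+b. u (a, b) \<partial>\<kappa> a)) \<in> borel_measurable M"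
    using mult by measurable
  ultimately show ?case by (subst measurable_cong) auto
next
  case (add u v)
  have "(\<integral>\<^sup>+b. v (a, b) + u (a, b) \<partial>\<kappa> a) = (\<integral>\<^sup>+b. v (a, b) \<partial>\<kappa> a) + (\<integral>\<^sup>+b. u (a, b) \<partial>\<kappa> a)"
    if "a \<in> space M" for a
    using add that by (intro nn_integral_add section_measurable)
  moreover have "(\<lambda>a. (\<integral>\<^sup>+b. v (a, b) \<partial>\<kappa> a) + (\<integral>\<^sup>+b. u (a, b) \<partial>\<kappa> a)) \<in> borel_measurable M"
    using add by measurable
  ultimately show ?case by (subst measurable_cong) auto
next
  case (seq U)
  have "(\<integral>\<^sup>+b. (SUP i. U i) (a, b) \<partial>\<kappa> a) = (SUP i. \<integral>\<^sup>+b. U i (a, b) \<partial>\<kappa> a)" if "a \<in> space M" for a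
    unfolding SUP_apply using seq that
    by (intro nn_integral_monotone_convergence_SUP section_measurable) (auto simp: incseq_def le_fun_def)
  moreover have "(\<lambda>a. SUP i. \<integral>\<^sup>+b. U i (a, b) \<partial>\<kappa> a) \<in> borel_measurable M"
    using seq by measurable
  ultimately show ?case by (subst measurable_cong) auto
qed

end

text \<open>For a probability measure \<open>M\<close> and a Markov kernel \<open>\<kappa>\<close> this is the joint law of a pair whose first
  component has law \<open>M\<close> and whose second has conditional law \<open>\<kappa> a\<close> given that the first is \<open>a\<close>.
  When \<open>\<kappa> a\<close> counts the points of a random set, it is the intensity measure of the pairs formed by
  the outcome and one of the points.\<close>
definition kernel_product :: "'a measure \<Rightarrow> ('a \<Rightarrow> 'b measure) \<Rightarrow> 'b measure \<Rightarrow> ('a \<times> 'b) measure" where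
  "kernel_product M \<kappa> N = measure_of (space M \<times> space N) (sets (M \<Otimes>\<^sub>M N))
     (\<lambda>A. \<integral>\<^sup>+a. emeasure (\<kappa> a) (Pair a -` A) \<partial>M)"

context sigma_finite_kernel
begin

abbreviation joint where "joint \<equiv> kernel_product M \<kappa> N"

lemma sets_kernel_product [measurable_cong]: "sets joint = sets (M \<Otimes>\<^sub>M N)"
  unfolding kernel_product_def space_pair_measure[symmetric] by (rule sets.sets_measure_of_eq)

lemma space_kernel_product: "space joint = space M \<times> space N"
  using sets_eq_imp_space_eq[OF sets_kernel_product] by (simp add: space_pair_measure)

lemma emeasure_kernel_product:
  assumes "A \<in> sets (M \<Otimes>\<^sub>M N)"
  shows "emeasure joint A = (\<integral>\<^sup>+a. emeasure (\<kappa> a) (Pair a -` A) \<partial>M)"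
proof (rule emeasure_measure_of[OF kernel_product_def])
  show "sets (M \<Otimes>\<^sub>M N) \<subseteq> Pow (space M \<times> space N)"
    by (metis sets.space_closed space_pair_measure)
  show "A \<in> sets joint" using assms by (simp add: sets_kernel_product)
  let ?\<mu> = "\<lambda>A. \<integral>\<^sup>+a. emeasure (\<kappa> a) (Pair a -` A) \<partial>M"
  show "positive (sets joint) ?\<mu>" by (simp add: positive_def)
  show "countably_additive (sets joint) ?\<mu>"
  proof (rule countably_additiveI)
    fix F :: "nat \<Rightarrow> _" assume F: "range F \<subseteq> sets joint" "disjoint_family F"
    then have Fs: "F i \<in> sets (M \<Otimes>\<^sub>M N)" for i by (auto simp: sets_kernel_product)
    have "(\<Sum>i. ?\<mu> (F i)) = (\<integral>\<^sup>+a. (\<Sum>i. emeasure (\<kappa> a) (Pair a -` F i)) \<partial>M)"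
      using Fs section_emeasure_measurable by (intro nn_integral_suminf[symmetric]) auto
    also have "\<dots> = ?\<mu> (\<Union>i. F i)"
    proof (rule nn_integral_cong)
      fix a assume a: "a \<in> space M"
      have "(\<Sum>i. emeasure (\<kappa> a) (Pair a -` F i)) = emeasure (\<kappa> a) (\<Union>i. Pair a -` F i)"
        using Fs section_sets[OF a]
        by (intro suminf_emeasure disjoint_family_on_bisimulation[OF F(2)]) auto
      then show "(\<Sum>i. emeasure (\<kappa> a) (Pair a -` F i)) = emeasure (\<kappa> a) (Pair a -` (\<Union>i. F i))"
        by (simp add: vimage_UN)
    qed
    finally show "(\<Sum>i. ?\<mu> (F i)) = ?\<mu> (\<Union>i. F i)" .
  qed
qed

lemma nn_integral_kernel_product:
  fixes f :: "_ \<Rightarrow> ennreal"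
  assumes "f \<in> borel_measurable (M \<Otimes>\<^sub>M N)"
  shows "(\<integral>\<^sup>+z. f z \<partial>joint) = (\<integral>\<^sup>+a. (\<integral>\<^sup>+b. f (a, b) \<partial>\<kappa> a) \<partial>M)"
  using assms
proof induction
  case (cong f g)
  have "(\<integral>\<^sup>+z. f z \<partial>joint) = (\<integral>\<^sup>+z. g z \<partial>joint)"
    using cong by (intro nn_integral_cong) (auto simp: space_kernel_product space_pair_measure)
  moreover have "(\<integral>\<^sup>+a. (\<integral>\<^sup>+b. f (a, b) \<partial>\<kappa> a) \<partial>M) = (\<integral>\<^sup>+a. (\<integral>\<^sup>+b. g (a, b) \<partial>\<kappa> a) \<partial>M)"
    using cong by (intro nn_integral_cong) (auto simp: space_kernel space_pair_measure)
  ultimately show ?case using cong by simp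
next
  case (set A)
  show ?case
    using set by (simp add: nn_integral_section sets_kernel_product emeasure_kernel_product cong: nn_integral_cong)
next
  case (mult u c)
  have "(\<integral>\<^sup>+b. c * u (a, b) \<partial>\<kappa> a) = c * (\<integral>\<^sup>+b. u (a, b) \<partial>\<kappa> a)" if "a \<in> space M" for a
    using mult that by (intro nn_integral_cmult section_measurable)
  moreover have "u \<in> borel_measurable joint" using mult by measurable
  ultimately show ?case
    using mult nn_integral_kernel_measurable by (simp add: nn_integral_cmult cong: nn_integral_cong)
next
  case (add u v)
  have "(\<integral>\<^sup>+b. v (a, b) + u (a, b) \<partial>\<kappa> a) = (\<integral>\<^sup>+b. v (a, b) \<partial>\<kappa> a) + (\<integral>\<^sup>+b. u (a, b) \<partial>\<kappa> a)"
    if "a \<in> space M" for a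
    using add that by (intro nn_integral_add section_measurable)
  moreover have "u \<in> borel_measurable joint" "v \<in> borel_measurable joint" using add by measurable
  ultimately show ?case
    using add nn_integral_kernel_measurable by (simp add: nn_integral_add cong: nn_integral_cong)
next
  case (seq U)
  have U: "(\<lambda>a. \<integral>\<^sup>+b. U i (a, b) \<partial>\<kappa> a) \<in> borel_measurable M" for i
    using seq nn_integral_kernel_measurable by blast
  have "(\<integral>\<^sup>+b. (SUP i. U i (a, b)) \<partial>\<kappa> a) = (SUP i. \<integral>\<^sup>+b. U i (a, b) \<partial>\<kappa> a)" if "a \<in> space M" for a
    using seq that
    by (intro nn_integral_monotone_convergence_SUP section_measurable) (auto simp: incseq_def le_fun_def)
  then have "(\<integral>\<^sup>+a. (\<integral>\<^sup>+b. (SUP i. U i (a, b)) \<partial>\<kappa> a) \<partial>M) = (\<integral>\<^sup>+a. (SUP i. \<integral>\<^sup>+b. U i (a, b) \<partial>\<kappa> a) \<partial>M)"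
    by (rule nn_integral_cong)
  also have "\<dots> = (SUP i. \<integral>\<^sup>+a. \<integral>\<^sup>+b. U i (a, b) \<partial>\<kappa> a \<partial>M)"
    using seq U by (intro nn_integral_monotone_convergence_SUP)
      (auto simp: incseq_def le_fun_def intro!: nn_integral_mono)
  also have "\<dots> = (SUP i. \<integral>\<^sup>+z. U i z \<partial>joint)" using seq by simp
  also have "\<dots> = (\<integral>\<^sup>+z. (SUP i. U i z) \<partial>joint)"
    using seq by (intro nn_integral_monotone_convergence_SUP[symmetric]) auto
  finally show ?case by (simp add: SUP_apply image_comp)
qed

end

section \<open>Haar measures\<close>

lemma borel_measurable_group_uminus [measurable (raw)]:
  fixes f :: "'a \<Rightarrow> 'x::topological_group_add"
  assumes "f \<in> borel_measurable M"
  shows "(\<lambda>z. - f z) \<in> borel_measurable M"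
  using assms by (rule borel_measurable_continuous_on[rotated]) (intro continuous_intros)

text \<open>Every point has a compact neighbourhood, and by the Lindelof property countably many of
  their interiors cover the space.\<close>
lemma locally_compact_sigma_compact:
  assumes "locally_compact_space (euclidean :: 'x::second_countable_topology topology)"
  obtains K :: "nat \<Rightarrow> 'x::second_countable_topology set" where "\<And>i. compact (K i)" "(\<Union>i. K i) = UNIV"
proof -
  obtain U C where U: "\<And>x::'x. open (U x)" "\<And>x. compact (C x)" "\<And>x. x \<in> U x" "\<And>x. U x \<subseteq> C x"
    using assms unfolding locally_compact_space_def by simp metis
  obtain F where F: "F \<subseteq> range U" "countable F" "\<Union>F = \<Union>(range U)"
    using Lindelof[of "range U"] U(1) by (metis (full_types) imageE)
  obtain I where I: "countable I" "F = U ` I"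
    using F(1,2) by (meson countable_subset_image)
  have cover: "(\<Union>x\<in>I. C x) = UNIV" using F(3) I U(3,4) by blast
  then have "I \<noteq> {}" by auto
  show thesis
  proof
    show "compact (C (from_nat_into I i))" for i by (rule U(2))
    show "(\<Union>i. C (from_nat_into I i)) = UNIV"
      using cover range_from_nat_into[OF \<open>I \<noteq> {}\<close> I(1)] by (metis image_image)
  qed
qed

lemma borel_measurable_group_diff [measurable (raw)]:
  fixes f g :: "'a \<Rightarrow> 'x::{topological_group_add, second_countable_topology}"
  assumes "f \<in> borel_measurable M" "g \<in> borel_measurable M"
  shows "(\<lambda>z. f z - g z) \<in> borel_measurable M"
  unfolding diff_conv_add_uminus using assms by measurable

locale haar_group =
  fixes L :: "'x::{topological_group_add, second_countable_topology, t2_space} measure"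
    and \<Delta> :: "'x \<Rightarrow> real"
  assumes locally_compact: "locally_compact_space (euclidean :: 'x topology)"
    and haar: "left_haar_measure L"
    and modular: "is_modular_function L \<Delta>"
begin

lemma sets_haar [measurable_cong, simp]: "sets L = sets borel"
  using haar by (simp add: left_haar_measure_def)

lemma space_haar [simp]: "space L = UNIV"
  using sets_eq_imp_space_eq[OF sets_haar] by simp

lemma haar_compact: "compact K \<Longrightarrow> emeasure L K < \<infinity>"
  using haar by (simp add: left_haar_measure_def)

lemma haar_nonzero: "emeasure L UNIV \<noteq> 0"
  using haar by (simp add: left_haar_measure_def)

lemma sigma_finite_haar: "sigma_finite_measure L"
proof -
  obtain K :: "nat \<Rightarrow> 'x set" where K: "\<And>i. compact (K i)" "(\<Union>i. K i) = UNIV"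
    using locally_compact_sigma_compact[OF locally_compact] by blast
  show ?thesis
  proof
    show "\<exists>A. countable A \<and> A \<subseteq> sets L \<and> \<Union> A = space L \<and> (\<forall>a\<in>A. emeasure L a \<noteq> \<infinity>)"
      using K haar_compact
      by (intro exI[of _ "range K"]) (auto intro!: borel_compact simp: less_top)
  qed
qed

sublocale haar: sigma_finite_measure L by (rule sigma_finite_haar)

lemma positive_finite_set:
  obtains B where "B \<in> sets borel" "0 < emeasure L B" "emeasure L B < \<infinity>"
proof -
  obtain K :: "nat \<Rightarrow> 'x set" where K: "\<And>i. compact (K i)" "(\<Union>i. K i) = UNIV"
    using locally_compact_sigma_compact[OF locally_compact] by blast
  have Ks: "range K \<subseteq> sets L" using K(1) borel_compact by auto
  have "\<exists>i. emeasure L (K i) \<noteq> 0"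
    using emeasure_UN_eq_0[OF _ Ks] K(2) haar_nonzero by auto
  then show thesis using that K(1) haar_compact borel_compact by (metis not_gr_zero)
qed

lemma left_invariant: "distr L borel ((+) x) = L"
proof (rule measure_eqI)
  fix B assume "B \<in> sets (distr L borel ((+) x))"
  then have B[measurable]: "B \<in> sets borel" by simp
  have "emeasure (distr L borel ((+) x)) B = emeasure L ((+) x -` B)"
    by (subst emeasure_distr) auto
  also have "(+) x -` B = (\<lambda>b. - x + b) ` B"
    by (auto simp: image_iff add.assoc[symmetric] intro!: bexI[of _ "x + _"])
  also have "emeasure L ((\<lambda>b. - x + b) ` B) = emeasure L B"
    using haar B unfolding left_haar_measure_def by blast
  finally show "emeasure (distr L borel ((+) x)) B = emeasure L B" .
qed simp

lemma nn_integral_left_translate: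
  "f \<in> borel_measurable borel \<Longrightarrow> (\<integral>\<^sup>+x. f (y + x) \<partial>L) = (\<integral>\<^sup>+x. f x \<partial>L)"
  by (subst (2) left_invariant[of y, symmetric]) (simp add: nn_integral_distr)

lemma modular_pos: "0 < \<Delta> x"
  using modular by (simp add: is_modular_function_def)

lemma emeasure_right_translate:
  "B \<in> sets borel \<Longrightarrow> emeasure L ((\<lambda>b. b + x) -` B) = ennreal (\<Delta> (- x)) * emeasure L B"
proof -
  assume B: "B \<in> sets borel"
  have "(\<lambda>b. b + x) -` B = (\<lambda>b. b + - x) ` B"
    by (auto simp: image_iff add.assoc intro!: bexI[of _ "_ + x"])
  then show ?thesis using modular B unfolding is_modular_function_def by metis
qed

lemma nn_integral_right_translate:
  assumes [measurable]: "f \<in> borel_measurable borel"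
  shows "(\<integral>\<^sup>+x. f (x + y) \<partial>L) = ennreal (\<Delta> (- y)) * (\<integral>\<^sup>+x. f x \<partial>L)"
proof -
  have "distr L borel (\<lambda>x. x + y) = scale_measure (ennreal (\<Delta> (- y))) L"
    by (rule measure_eqI) (simp_all add: emeasure_distr emeasure_right_translate)
  then have "(\<integral>\<^sup>+x. f x \<partial>distr L borel (\<lambda>x. x + y)) = ennreal (\<Delta> (- y)) * (\<integral>\<^sup>+x. f x \<partial>L)"
    by (simp add: nn_integral_scale_measure)
  then show ?thesis by (simp add: nn_integral_distr)
qed

text \<open>Both sides are the factor by which translating a fixed set of positive finite measure by
  \<open>x\<close> and then by \<open>y\<close> multiplies its mass.\<close>
lemma modular_add: "\<Delta> (x + y) = \<Delta> x * \<Delta> y"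
proof -
  obtain B where B: "B \<in> sets borel" "0 < emeasure L B" "emeasure L B < \<infinity>"
    using positive_finite_set .
  have tr: "emeasure L ((\<lambda>b. b + z) ` A) = ennreal (\<Delta> z) * emeasure L A" if "A \<in> sets borel" for z A
    using modular that by (auto simp: is_modular_function_def)
  have "(\<lambda>b. b + x) ` B = (\<lambda>b. b + - x) -` B"
    by (auto simp: image_iff add.assoc intro!: bexI[of _ "_ + - x"])
  moreover have "(\<lambda>b. b + - x) -` B \<in> sets borel"
    by (rule measurable_sets_borel[OF _ B(1)]) measurable
  ultimately have Bx: "(\<lambda>b. b + x) ` B \<in> sets borel" by simp
  have "(\<lambda>b. b + (x + y)) ` B = (\<lambda>b. b + y) ` (\<lambda>b. b + x) ` B"
    by (simp add: image_image add.assoc)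
  then have "ennreal (\<Delta> (x + y)) * emeasure L B = ennreal (\<Delta> y) * (ennreal (\<Delta> x) * emeasure L B)"
    using tr[OF B(1), of "x + y"] tr[OF Bx, of y] tr[OF B(1), of x] by simp
  also have "\<dots> = ennreal (\<Delta> x * \<Delta> y) * emeasure L B"
    using modular_pos[of x] modular_pos[of y] by (simp add: ennreal_mult less_imp_le ac_simps)
  finally have "ennreal (\<Delta> (x + y)) = ennreal (\<Delta> x * \<Delta> y)"
    using B by (metis less_irrefl infinity_ennreal_def mult_divide_eq_ennreal)
  then show ?thesis using modular_pos by (simp add: less_imp_le)
qed

lemma modular_diff_eq_1_iff: "\<Delta> (- x + y) = 1 \<longleftrightarrow> \<Delta> x = \<Delta> y"
  using modular_add[of x "- x + y"] modular_pos[of x] by (auto simp: add.assoc[symmetric])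

text \<open>For a set \<open>B\<close> of positive finite measure, \<^term>\<open>\<Delta> x\<close> is the mass of the right translate of
  \<open>B\<close> by \<open>x\<close> divided by that of \<open>B\<close>, and the numerator is a section integral of a jointly
  measurable function.\<close>
lemma modular_measurable [measurable]: "\<Delta> \<in> borel_measurable borel"
proof -
  obtain B where B[measurable]: "B \<in> sets borel" and Bp: "0 < emeasure L B" "emeasure L B < \<infinity>"
    using positive_finite_set .
  have "(\<lambda>x. \<integral>\<^sup>+y. indicator B (y + - x) \<partial>L) \<in> borel_measurable borel"
    by measurable
  also have "(\<lambda>x. \<integral>\<^sup>+y. indicator B (y + - x) \<partial>L) = (\<lambda>x. ennreal (\<Delta> x) * emeasure L B)"
  proof
    fix x
    show "(\<integral>\<^sup>+y. indicator B (y + - x) \<partial>L) = ennreal (\<Delta> x) * emeasure L B"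
      using nn_integral_right_translate[of "indicator B" "- x"] by simp
  qed
  finally have "(\<lambda>x. ennreal (\<Delta> x) * emeasure L B / emeasure L B) \<in> borel_measurable borel"
    by measurable
  also have "(\<lambda>x. ennreal (\<Delta> x) * emeasure L B / emeasure L B) = (\<lambda>x. ennreal (\<Delta> x))"
    using Bp by (simp add: ennreal_mult_divide_eq less_top[symmetric] mult_divide_eq_ennreal)
  finally have "(\<lambda>x. enn2real (ennreal (\<Delta> x))) \<in> borel_measurable borel"
    by measurable
  then show ?thesis using modular_pos by (simp add: less_imp_le)
qed

text \<open>Uniqueness of Haar measure, by Tonelli: the substitutions \<open>x \<mapsto> - y + x\<close> for \<open>L\<close>,
  \<open>y \<mapsto> x + y\<close> for \<open>\<nu>\<close> and \<open>x \<mapsto> x + y\<close> for \<open>L\<close> turn \<open>f y * w x\<close> into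
  \<open>f x * w (- y) * \<Delta> (- y)\<close>. Hence the \<open>\<nu>\<close>-integral of \<open>f\<close> is the \<open>L\<close>-integral of \<open>f\<close> times a
  constant, and \<open>f = w\<close> identifies the constant.\<close>
lemma left_invariant_measure_unique:
  fixes w :: "'x \<Rightarrow> ennreal"
  assumes "sigma_finite_measure \<nu>" and sets[measurable_cong]: "sets \<nu> = sets borel"
    and inv: "\<And>x. distr \<nu> borel ((+) x) = \<nu>"
    and w[measurable]: "w \<in> borel_measurable borel" and w1: "(\<integral>\<^sup>+x. w x \<partial>L) = 1"
    and f: "f \<in> borel_measurable borel"
  shows "(\<integral>\<^sup>+x. f x \<partial>\<nu>) = (\<integral>\<^sup>+x. w x \<partial>\<nu>) * (\<integral>\<^sup>+x. f x \<partial>L)"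
proof -
  interpret \<nu>: sigma_finite_measure \<nu> by fact
  interpret pair_sigma_finite L \<nu> ..
  have inv_int: "(\<integral>\<^sup>+y. g (x + y) \<partial>\<nu>) = (\<integral>\<^sup>+y. g y \<partial>\<nu>)"
    if "g \<in> borel_measurable borel" for g :: "'x \<Rightarrow> ennreal" and x
    using that by (subst (2) inv[of x, symmetric]) (simp add: nn_integral_distr cong: measurable_cong_sets)
  define c where "c = (\<integral>\<^sup>+y. w (- y) * ennreal (\<Delta> (- y)) \<partial>\<nu>)"
  have main: "(\<integral>\<^sup>+x. g x \<partial>\<nu>) = c * (\<integral>\<^sup>+x. g x \<partial>L)" if g[measurable]: "g \<in> borel_measurable borel" for g
  proof -
    have "(\<integral>\<^sup>+y. g y \<partial>\<nu>) = (\<integral>\<^sup>+y. (\<integral>\<^sup>+x. g y * w (- y + x) \<partial>L) \<partial>\<nu>)"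
      by (simp add: nn_integral_cmult nn_integral_left_translate w1)
    also have "\<dots> = (\<integral>\<^sup>+x. (\<integral>\<^sup>+y. g y * w (- y + x) \<partial>\<nu>) \<partial>L)"
      by (rule Fubini') measurable
    also have "\<dots> = (\<integral>\<^sup>+x. (\<integral>\<^sup>+y. g (x + y) * w (- y) \<partial>\<nu>) \<partial>L)"
    proof (rule nn_integral_cong)
      fix x
      have "(\<integral>\<^sup>+y. g y * w (- y + x) \<partial>\<nu>) = (\<integral>\<^sup>+y. g (x + y) * w (- (x + y) + x) \<partial>\<nu>)"
        by (rule inv_int[symmetric]) measurable
      then show "(\<integral>\<^sup>+y. g y * w (- y + x) \<partial>\<nu>) = (\<integral>\<^sup>+y. g (x + y) * w (- y) \<partial>\<nu>)"
        by (simp add: minus_add add.assoc)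
    qed
    also have "\<dots> = (\<integral>\<^sup>+y. (\<integral>\<^sup>+x. g (x + y) * w (- y) \<partial>L) \<partial>\<nu>)"
      by (rule Fubini'[symmetric]) measurable
    also have "\<dots> = (\<integral>\<^sup>+y. w (- y) * ennreal (\<Delta> (- y)) * (\<integral>\<^sup>+x. g x \<partial>L) \<partial>\<nu>)"
    proof (rule nn_integral_cong)
      fix y
      have "(\<integral>\<^sup>+x. g (x + y) * w (- y) \<partial>L) = (\<integral>\<^sup>+x. g (x + y) \<partial>L) * w (- y)"
        by (rule nn_integral_multc) measurable
      then show "(\<integral>\<^sup>+x. g (x + y) * w (- y) \<partial>L) = w (- y) * ennreal (\<Delta> (- y)) * (\<integral>\<^sup>+x. g x \<partial>L)"
        by (simp add: nn_integral_right_translate mult_ac)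
    qed
    also have "\<dots> = c * (\<integral>\<^sup>+x. g x \<partial>L)"
      unfolding c_def by (rule nn_integral_multc) measurable
    finally show ?thesis .
  qed
  show ?thesis using main[OF f] main[OF w] w1 by simp
qed

end

section \<open>Counting measures\<close>

text \<open>If every point had an open neighbourhood of mass below one, hence zero, then countably many of
  these would cover the space. So all neighbourhoods of some point have mass at least one, and
  intersecting a countable neighbourhood base leaves that mass on the point itself.\<close>
lemma integer_valued_measure_atom:
  fixes \<nu> :: "'x::{second_countable_topology, t2_space} measure"
  assumes sets: "sets \<nu> = sets borel" and fin: "emeasure \<nu> UNIV < \<infinity>" and pos: "emeasure \<nu> UNIV \<noteq> 0"
    and int: "\<And>B. B \<in> sets borel \<Longrightarrow> emeasure \<nu> B = 0 \<or> 1 \<le> emeasure \<nu> B"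
  obtains x where "1 \<le> emeasure \<nu> {x}"
proof -
  have "\<exists>x. \<forall>U. open U \<longrightarrow> x \<in> U \<longrightarrow> 1 \<le> emeasure \<nu> U"
  proof (rule ccontr)
    assume "\<not> ?thesis"
    then obtain U where U: "\<And>x. open (U x)" "\<And>x. x \<in> U x" "\<And>x. emeasure \<nu> (U x) = 0"
      using int by (metis borel_open)
    obtain F where F: "F \<subseteq> range U" "countable F" "\<Union>F = \<Union>(range U)"
      using Lindelof[of "range U"] U(1) by (metis (full_types) imageE)
    have "F \<subseteq> null_sets \<nu>" using F(1) U(1,3) sets by (auto simp: null_sets_def)
    then have "\<Union>F \<in> null_sets \<nu>"
      using null_sets_UN'[OF F(2), of "\<lambda>U. U" \<nu>] by auto
    moreover have "\<Union>F = UNIV" using F(3) U(2) by blast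
    ultimately show False using pos by (simp add: null_sets_def)
  qed
  then obtain x where x: "\<And>U. open U \<Longrightarrow> x \<in> U \<Longrightarrow> 1 \<le> emeasure \<nu> U" by blast
  obtain A where A: "\<And>i. open (A i)" "\<And>i. x \<in> A i"
      "\<And>S. open S \<Longrightarrow> x \<in> S \<Longrightarrow> eventually (\<lambda>i. A i \<subseteq> S) sequentially"
    using countable_basis_at_decseq[of x] by blast
  \<comment> \<open>Finite intersections make the base decreasing, for continuity from above.\<close>
  define D where "D n = (\<Inter>i\<le>n. A i)" for n
  have D: "open (D n)" "x \<in> D n" for n unfolding D_def using A by auto
  have "(\<Inter>n. D n) = {x}"
  proof -
    have "\<exists>n. y \<notin> D n" if "y \<noteq> x" for y
    proof -
      have "eventually (\<lambda>i. A i \<subseteq> - {y}) sequentially" using A(3)[of "- {y}"] that by auto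
      then obtain i where "A i \<subseteq> - {y}" by (auto simp: eventually_sequentially)
      then show ?thesis unfolding D_def by (intro exI[of _ i]) auto
    qed
    then show ?thesis using D(2) by blast
  qed
  moreover have "(\<lambda>n. emeasure \<nu> (D n)) \<longlonglongrightarrow> emeasure \<nu> (\<Inter>n. D n)"
  proof (rule Lim_emeasure_decseq)
    show "range D \<subseteq> sets \<nu>" using D sets by auto
    show "decseq D" unfolding D_def decseq_def by auto
    show "emeasure \<nu> (D i) \<noteq> \<infinity>" for i
      using fin emeasure_mono[of "D i" UNIV \<nu>] sets by (auto simp: top_unique)
  qed
  ultimately have "(\<lambda>n. emeasure \<nu> (D n)) \<longlonglongrightarrow> emeasure \<nu> {x}" by simp
  then have "1 \<le> emeasure \<nu> {x}"
    by (rule LIMSEQ_le_const) (use x D in blast)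
  then show thesis by (rule that)
qed

locale simple_counting_measure =
  fixes \<mu> :: "'x::{second_countable_topology, t2_space} measure"
  assumes locally_compact: "locally_compact_space (euclidean :: 'x topology)"
    and counting: "locally_finite_counting_measure \<mu>"
    and simple: "emeasure \<mu> {x} \<in> {0, 1}"
begin

lemma sets_mu [measurable_cong, simp]: "sets \<mu> = sets borel"
  using counting by (simp add: locally_finite_counting_measure_def)

lemma points_iff: "x \<in> points \<mu> \<longleftrightarrow> emeasure \<mu> {x} = 1"
  using simple[of x] by (auto simp: points_def)

lemma finite_points_compact:
  assumes C: "compact C"
  shows "finite (points \<mu> \<inter> C)"
proof (rule ccontr)
  assume inf: "infinite (points \<mu> \<inter> C)"
  have Cs: "C \<in> sets \<mu>" using C by (simp add: borel_compact)
  have "emeasure \<mu> C < \<infinity>" "emeasure \<mu> C = \<infinity> \<or> (\<exists>n::nat. emeasure \<mu> C = of_nat n)"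
    using counting C borel_compact[OF C] unfolding locally_finite_counting_measure_def by auto
  then obtain n :: nat where n: "emeasure \<mu> C = of_nat n" by auto
  obtain F where F: "F \<subseteq> points \<mu> \<inter> C" "finite F" "card F = Suc n"
    using infinite_arbitrarily_large[OF inf] by blast
  have "of_nat (Suc n) = (\<Sum>x\<in>F. emeasure \<mu> {x})"
    using F points_iff by (subst sum.cong[of F F _ "\<lambda>_. 1"]) auto
  also have "\<dots> = emeasure \<mu> F"
    using F by (intro emeasure_eq_sum_singleton[symmetric]) auto
  also have "\<dots> \<le> of_nat n" using F(1) Cs by (subst n[symmetric], intro emeasure_mono) auto
  finally show False using of_nat_le_iff[where ?'a = ennreal, of "Suc n" n] by simp
qed

lemma countable_points: "countable (points \<mu>)"
proof -
  obtain K :: "nat \<Rightarrow> 'x set" where K: "\<And>i. compact (K i)" "(\<Union>i. K i) = UNIV"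
    using locally_compact_sigma_compact[OF locally_compact] by blast
  have "countable (\<Union>i. points \<mu> \<inter> K i)"
    using finite_points_compact[OF K(1)] by (auto intro!: countable_UN intro: countable_finite simp del: UN_simps)
  moreover have "points \<mu> = (\<Union>i. points \<mu> \<inter> K i)" using K(2) by blast
  ultimately show ?thesis by simp
qed

lemma points_borel [measurable]: "points \<mu> \<in> sets borel"
proof -
  have "(\<Union>x\<in>points \<mu>. {x}) \<in> sets borel"
    using countable_points by (intro sets.countable_UN') auto
  then show ?thesis by simp
qed

text \<open>The restriction of \<open>\<mu>\<close> to a compact set without its atoms is finite and integer valued, so it
  would have an atom if it were nonzero.\<close>
lemma no_diffuse_part: "emeasure \<mu> (- points \<mu>) = 0"
proof -
  obtain K :: "nat \<Rightarrow> 'x set" where K: "\<And>i. compact (K i)" "(\<Union>i. K i) = UNIV"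
    using locally_compact_sigma_compact[OF locally_compact] by blast
  have Ks[measurable]: "K i \<in> sets borel" for i using K(1) by (rule borel_compact)
  have "emeasure \<mu> (K i - points \<mu>) = 0" for i
  proof (rule ccontr)
    assume pos: "emeasure \<mu> (K i - points \<mu>) \<noteq> 0"
    let ?\<nu> = "density \<mu> (indicator (K i - points \<mu>))"
    have \<nu>: "emeasure ?\<nu> B = emeasure \<mu> ((K i - points \<mu>) \<inter> B)" if "B \<in> sets borel" for B
      using that by (intro emeasure_restricted) auto
    have "emeasure ?\<nu> UNIV \<le> emeasure \<mu> (K i)"
      by (auto simp: \<nu> intro!: emeasure_mono)
    also have "\<dots> < \<infinity>"
      using counting K(1) by (simp add: locally_finite_counting_measure_def)
    finally have fin: "emeasure ?\<nu> UNIV < \<infinity>" .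
    have int: "emeasure ?\<nu> B = 0 \<or> 1 \<le> emeasure ?\<nu> B" if B: "B \<in> sets borel" for B
    proof -
      have "(K i - points \<mu>) \<inter> B \<in> sets borel" using B by measurable
      then consider "emeasure ?\<nu> B = \<infinity>" | n :: nat where "emeasure ?\<nu> B = of_nat n"
        using counting \<nu>[OF B] unfolding locally_finite_counting_measure_def by metis
      then show ?thesis by cases (auto simp: Suc_le_eq[symmetric] gr0_conv_Suc)
    qed
    obtain x where x: "1 \<le> emeasure ?\<nu> {x}"
      using integer_valued_measure_atom[of ?\<nu>] fin pos int by (auto simp: \<nu>)
    show False
    proof (cases "x \<in> K i - points \<mu>")
      case True
      then have "(K i - points \<mu>) \<inter> {x} = {x}" "emeasure \<mu> {x} = 0" by (auto simp: points_def)
      then show False using x by (simp add: \<nu>)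
    next
      case False
      then have "(K i - points \<mu>) \<inter> {x} = {}" by auto
      then show False using x by (simp add: \<nu>)
    qed
  qed
  then have "emeasure \<mu> (\<Union>i. K i - points \<mu>) = 0"
    by (intro emeasure_UN_eq_0) auto
  moreover have "(\<Union>i. K i - points \<mu>) = - points \<mu>" using K(2) by auto
  ultimately show ?thesis by simp
qed

lemma AE_points: "AE x in \<mu>. x \<in> points \<mu>"
  using no_diffuse_part by (intro AE_I[of _ _ "- points \<mu>"]) auto

lemma emeasure_eq_count:
  assumes B[measurable]: "B \<in> sets borel"
  shows "emeasure \<mu> B = emeasure (count_space UNIV) (points \<mu> \<inter> B)"
proof -
  have "emeasure \<mu> B = emeasure \<mu> (points \<mu> \<inter> B)"
    using AE_points by (intro emeasure_eq_AE) auto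
  also have "\<dots> = (\<integral>\<^sup>+x. emeasure \<mu> {x} \<partial>count_space (points \<mu> \<inter> B))"
    using countable_points by (intro emeasure_countable_singleton) auto
  also have "\<dots> = (\<integral>\<^sup>+x. 1 \<partial>count_space (points \<mu> \<inter> B))"
    using points_iff by (intro nn_integral_cong) auto
  also have "\<dots> = emeasure (count_space UNIV) (points \<mu> \<inter> B)"
    by (simp add: emeasure_count_space)
  finally show ?thesis .
qed

lemma emeasure_eq_0_iff: "B \<in> sets borel \<Longrightarrow> emeasure \<mu> B = 0 \<longleftrightarrow> points \<mu> \<inter> B = {}"
  by (simp add: emeasure_eq_count emeasure_count_space_eq_0)

lemma emeasure_eq_1_iff: "B \<in> sets borel \<Longrightarrow> emeasure \<mu> B = 1 \<longleftrightarrow> (\<exists>!x. x \<in> points \<mu> \<and> x \<in> B)"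
proof -
  assume "B \<in> sets borel"
  then have "emeasure \<mu> B = 1 \<longleftrightarrow> card (points \<mu> \<inter> B) = 1"
    by (auto simp: emeasure_eq_count emeasure_count_space)
  also have "\<dots> \<longleftrightarrow> (\<exists>!x. x \<in> points \<mu> \<and> x \<in> B)"
    unfolding card_1_singleton_iff One_nat_def by (auto simp: set_eq_iff Ex1_def)
  finally show ?thesis .
qed

text \<open>Permuting the points does not change how many of them lie in a given set.\<close>
lemma distr_bij_points:
  assumes f[measurable]: "f \<in> borel_measurable borel" and bij: "bij_betw f (points \<mu>) (points \<mu>)"
  shows "distr \<mu> borel f = \<mu>"
proof (rule measure_eqI)
  fix B assume "B \<in> sets (distr \<mu> borel f)"
  then have B[measurable]: "B \<in> sets borel" by simp
  have fB: "f -` B \<in> sets borel" using measurable_sets_borel[OF f B] .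
  have "bij_betw f (points \<mu> \<inter> f -` B) (points \<mu> \<inter> B)"
  proof (rule bij_betw_subset[OF bij])
    have "f ` (points \<mu> \<inter> f -` B) = f ` points \<mu> \<inter> B" by auto
    then show "f ` (points \<mu> \<inter> f -` B) = points \<mu> \<inter> B" using bij by (simp add: bij_betw_def)
  qed auto
  then have "finite (points \<mu> \<inter> f -` B) = finite (points \<mu> \<inter> B)"
    "card (points \<mu> \<inter> f -` B) = card (points \<mu> \<inter> B)"
    by (rule bij_betw_finite, rule bij_betw_same_card)
  then have "emeasure \<mu> (f -` B) = emeasure \<mu> B"
    by (simp add: emeasure_eq_count fB emeasure_count_space)
  moreover have "space \<mu> = UNIV" using sets_eq_imp_space_eq[OF sets_mu] by simp
  ultimately show "emeasure (distr \<mu> borel f) B = emeasure \<mu> B"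
    by (subst emeasure_distr) auto
qed simp

end

section \<open>The Campbell measure and its disintegration\<close>

locale stationary_point_process = haar_group L \<Delta> + stationary_framework P \<theta>
  for L :: "'x::{topological_group_add, second_countable_topology, t2_space} measure"
    and \<Delta> and P :: "'w measure" and \<theta> :: "'x \<Rightarrow> 'w \<Rightarrow> 'w" +
  fixes m :: "'w \<Rightarrow> 'x measure" and \<gamma> :: real and w :: "'x \<Rightarrow> real"
  assumes process: "simple_point_process P m"
    and adapted: "flow_adapted P \<theta> m"
    and intensity_pos: "0 < \<gamma>"
    and intensity: "has_intensity L P m \<gamma>"
    and weight_measurable [measurable]: "w \<in> borel_measurable borel"
    and weight_integral: "(\<integral>\<^sup>+x. ennreal (w x) \<partial>L) = 1"
begin

lemma simple_counting: "\<omega> \<in> space P \<Longrightarrow> simple_counting_measure (m \<omega>)"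
  using process locally_compact
  by (auto simp: simple_point_process_def simple_counting_measure_def)

text \<open>One cover is chosen for all realizations, since \<^locale>\<open>sigma_finite_kernel\<close> needs pieces that
  do not depend on \<open>\<omega>\<close>.\<close>
definition compact_cover :: "nat \<Rightarrow> 'x set" where
  "compact_cover = (SOME F. (\<forall>i. compact (F i)) \<and> (\<Union>i. F i) = UNIV)"

lemma compact_cover: "compact (compact_cover i)" "(\<Union>i. compact_cover i) = UNIV"
proof -
  have "\<exists>F :: nat \<Rightarrow> 'x set. (\<forall>i. compact (F i)) \<and> (\<Union>i. F i) = UNIV"
    by (rule locally_compact_sigma_compact[OF locally_compact]) blast
  from someI_ex[OF this] show "compact (compact_cover i)" "(\<Union>i. compact_cover i) = UNIV" by (auto simp: compact_cover_def)
qed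

sublocale kernel: sigma_finite_kernel P borel m compact_cover
proof
  fix \<omega> i assume \<omega>: "\<omega> \<in> space P"
  interpret simple_counting_measure "m \<omega>" using simple_counting[OF \<omega>] .
  show "sets (m \<omega>) = sets borel" by simp
  show "emeasure (m \<omega>) (compact_cover i) < \<infinity>"
    using counting compact_cover(1) by (simp add: locally_finite_counting_measure_def)
next
  fix B :: "'x set" assume "B \<in> sets borel"
  then show "(\<lambda>\<omega>. emeasure (m \<omega>) B) \<in> borel_measurable P"
    using process by (simp add: simple_point_process_def)
qed (use compact_cover in \<open>auto intro: borel_compact\<close>)

lemma expected_count:
  assumes "B \<in> sets borel" "0 < emeasure L B" "emeasure L B < \<infinity>"
  shows "(\<integral>\<^sup>+\<omega>. emeasure (m \<omega>) B \<partial>P) = ennreal \<gamma> * emeasure L B"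
proof -
  have "(\<integral>\<^sup>+\<omega>. emeasure (m \<omega>) B \<partial>P) / emeasure L B = ennreal \<gamma>"
    using assms intensity by (simp add: has_intensity_def)
  then show ?thesis
    using assms(2,3) ennreal_divide_times[of "\<integral>\<^sup>+\<omega>. emeasure (m \<omega>) B \<partial>P" "emeasure L B" "emeasure L B"]
    by (simp add: less_top[symmetric])
qed

text \<open>The intensity only speaks of sets of positive finite Haar measure. Enlarging a compact set
  by such a set makes it one of them, even if it had Haar measure zero itself.\<close>
lemma expected_count_compact_finite:
  assumes C: "compact C"
  shows "(\<integral>\<^sup>+\<omega>. emeasure (m \<omega>) C \<partial>P) < \<infinity>"
proof -
  obtain B where B: "B \<in> sets borel" "0 < emeasure L B" "emeasure L B < \<infinity>"
    using positive_finite_set by blast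
  have Cs: "C \<in> sets borel" using C by (rule borel_compact)
  have "emeasure L B \<le> emeasure L (C \<union> B)" using B Cs by (intro emeasure_mono) auto
  then have "0 < emeasure L (C \<union> B)" using B(2) by order
  moreover have "emeasure L (C \<union> B) \<le> emeasure L C + emeasure L B"
    using B Cs by (intro emeasure_subadditive) auto
  then have "emeasure L (C \<union> B) < \<infinity>"
    using haar_compact[OF C] B(3) by (simp add: order_le_less_trans)
  ultimately have "(\<integral>\<^sup>+\<omega>. emeasure (m \<omega>) (C \<union> B) \<partial>P) < \<infinity>"
    using B Cs by (subst expected_count) (auto simp: ennreal_mult_less_top)
  moreover have "(\<integral>\<^sup>+\<omega>. emeasure (m \<omega>) C \<partial>P) \<le> (\<integral>\<^sup>+\<omega>. emeasure (m \<omega>) (C \<union> B) \<partial>P)"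
    using B Cs by (intro nn_integral_mono emeasure_mono) (auto simp: kernel.sets_kernel)
  ultimately show ?thesis by order
qed

lemma flow_space: "\<omega> \<in> space P \<Longrightarrow> \<theta> x \<omega> \<in> space P"
  using measurable_space[OF flow_measurable, of "(x, \<omega>)"] by (simp add: space_pair_measure)

lemma flow_borel [measurable (raw)]:
  assumes "f \<in> borel_measurable N" "g \<in> N \<rightarrow>\<^sub>M P"
  shows "(\<lambda>z. \<theta> (f z) (g z)) \<in> N \<rightarrow>\<^sub>M P"
  using measurable_compose[OF measurable_Pair[OF assms] flow_measurable] by simp

lemma process_shift: "\<omega> \<in> space P \<Longrightarrow> m (\<theta> y \<omega>) = distr (m \<omega>) borel ((+) y)"
proof (rule measure_eqI)
  assume \<omega>: "\<omega> \<in> space P"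
  show "sets (m (\<theta> y \<omega>)) = sets (distr (m \<omega>) borel ((+) y))"
    using \<omega> by (simp add: kernel.sets_kernel flow_space)
  fix B assume "B \<in> sets (m (\<theta> y \<omega>))"
  then have B: "B \<in> sets borel" using \<omega> by (simp add: kernel.sets_kernel flow_space)
  have "(\<lambda>b. - y + b) ` B = (+) y -` B"
    by (auto simp: image_iff add.assoc[symmetric] intro!: bexI[of _ "y + _"])
  then have "emeasure (m (\<theta> y \<omega>)) B = emeasure (m \<omega>) ((+) y -` B)"
    using adapted B \<omega> by (simp add: flow_adapted_def)
  also have "\<dots> = emeasure (distr (m \<omega>) borel ((+) y)) B"
    using B \<omega> by (subst emeasure_distr)
      (auto simp: kernel.space_kernel measurable_cong_sets[OF kernel.sets_kernel refl])
  finally show "emeasure (m (\<theta> y \<omega>)) B = emeasure (distr (m \<omega>) borel ((+) y)) B" .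
qed

lemma points_shift: "\<omega> \<in> space P \<Longrightarrow> points (m (\<theta> y \<omega>)) = (+) y ` points (m \<omega>)"
proof -
  assume \<omega>: "\<omega> \<in> space P"
  have "x \<in> points (m (\<theta> y \<omega>)) \<longleftrightarrow> - y + x \<in> points (m \<omega>)" for x
    using adapted \<omega> unfolding flow_adapted_def points_def by simp
  moreover have "x \<in> (+) y ` A \<longleftrightarrow> - y + x \<in> A" for x and A :: "'x set"
    by (auto simp: image_iff add.assoc[symmetric] intro!: bexI[of _ "- y + x"])
  ultimately show ?thesis by blast
qed

text \<open>The Campbell measure counts each point together with the realization as seen from it.\<close>
abbreviation campbell where "campbell \<equiv> distr kernel.joint (borel \<Otimes>\<^sub>M P) (\<lambda>(\<omega>, x). (x, \<theta> (- x) \<omega>))"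

lemma nn_integral_campbell:
  fixes f :: "_ \<Rightarrow> ennreal"
  assumes [measurable]: "f \<in> borel_measurable (borel \<Otimes>\<^sub>M P)"
  shows "(\<integral>\<^sup>+z. f z \<partial>campbell) = (\<integral>\<^sup>+\<omega>. (\<integral>\<^sup>+x. f (x, \<theta> (- x) \<omega>) \<partial>m \<omega>) \<partial>P)"
proof -
  have "(\<integral>\<^sup>+z. f z \<partial>campbell) = (\<integral>\<^sup>+z. f ((\<lambda>(\<omega>, x). (x, \<theta> (- x) \<omega>)) z) \<partial>kernel.joint)"
    by (rule nn_integral_distr) measurable
  also have "\<dots> = (\<integral>\<^sup>+\<omega>. (\<integral>\<^sup>+x. f ((\<lambda>(\<omega>, x). (x, \<theta> (- x) \<omega>)) (\<omega>, x)) \<partial>m \<omega>) \<partial>P)"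
    by (rule kernel.nn_integral_kernel_product) measurable
  also have "\<dots> = (\<integral>\<^sup>+\<omega>. (\<integral>\<^sup>+x. f (x, \<theta> (- x) \<omega>) \<partial>m \<omega>) \<partial>P)" by simp
  finally show ?thesis .
qed

lemma emeasure_campbell:
  "S \<in> sets (borel \<Otimes>\<^sub>M P) \<Longrightarrow>
    emeasure campbell S = (\<integral>\<^sup>+\<omega>. (\<integral>\<^sup>+x. indicator S (x, \<theta> (- x) \<omega>) \<partial>m \<omega>) \<partial>P)"
  using nn_integral_campbell[of "indicator S"] by simp

text \<open>Replacing \<open>\<omega>\<close> by \<open>\<theta> y \<omega>\<close> leaves \<open>P\<close> unchanged and moves each point from \<open>x\<close> to \<open>y + x\<close>,
  whereas the view from that point stays the same.\<close>
lemma nn_integral_campbell_shift: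
  fixes f :: "_ \<Rightarrow> ennreal"
  assumes f[measurable]: "f \<in> borel_measurable (borel \<Otimes>\<^sub>M P)"
  shows "(\<integral>\<^sup>+(x, \<omega>). f (y + x, \<omega>) \<partial>campbell) = (\<integral>\<^sup>+z. f z \<partial>campbell)"
proof -
  have [measurable]: "(\<lambda>\<omega>. \<integral>\<^sup>+x. f (x, \<theta> (- x) \<omega>) \<partial>m \<omega>) \<in> borel_measurable P"
    using kernel.nn_integral_kernel_measurable[of "\<lambda>(\<omega>, x). f (x, \<theta> (- x) \<omega>)"] by simp
  have "(\<integral>\<^sup>+z. f z \<partial>campbell) = (\<integral>\<^sup>+\<omega>. (\<integral>\<^sup>+x. f (x, \<theta> (- x) \<omega>) \<partial>m \<omega>) \<partial>distr P P (\<theta> y))"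
    by (simp add: nn_integral_campbell flow_preserves)
  also have "\<dots> = (\<integral>\<^sup>+\<omega>. (\<integral>\<^sup>+x. f (x, \<theta> (- x) (\<theta> y \<omega>)) \<partial>m (\<theta> y \<omega>)) \<partial>P)"
    by (rule nn_integral_distr) measurable
  also have "\<dots> = (\<integral>\<^sup>+\<omega>. (\<integral>\<^sup>+x. f (y + x, \<theta> (- x) \<omega>) \<partial>m \<omega>) \<partial>P)"
  proof (rule nn_integral_cong)
    fix \<omega> assume \<omega>: "\<omega> \<in> space P"
    have [measurable_cong]: "sets (m \<omega>) = sets borel" using \<omega> by (rule kernel.sets_kernel)
    have [measurable]: "\<theta> y \<omega> \<in> space P" using \<omega> by (rule flow_space)
    have "(\<integral>\<^sup>+x. f (x, \<theta> (- x) (\<theta> y \<omega>)) \<partial>m (\<theta> y \<omega>))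
        = (\<integral>\<^sup>+x. f (y + x, \<theta> (- (y + x)) (\<theta> y \<omega>)) \<partial>m \<omega>)"
      unfolding process_shift[OF \<omega>] by (rule nn_integral_distr) measurable
    also have "\<dots> = (\<integral>\<^sup>+x. f (y + x, \<theta> (- x) \<omega>) \<partial>m \<omega>)"
      using \<omega> by (simp add: flow_add[symmetric] minus_add add.assoc)
    finally show "(\<integral>\<^sup>+x. f (x, \<theta> (- x) (\<theta> y \<omega>)) \<partial>m (\<theta> y \<omega>)) = (\<integral>\<^sup>+x. f (y + x, \<theta> (- x) \<omega>) \<partial>m \<omega>)" .
  qed
  also have "\<dots> = (\<integral>\<^sup>+(x, \<omega>). f (y + x, \<omega>) \<partial>campbell)"
  proof -
    have "(\<lambda>(x, \<omega>). f (y + x, \<omega>)) \<in> borel_measurable (borel \<Otimes>\<^sub>M P)" by measurable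
    from nn_integral_campbell[OF this] show ?thesis by simp
  qed
  finally show ?thesis by simp
qed

text \<open>The Palm measure before division by the intensity. Written as an image of a density it
  is a measure by construction, and the defining formula of \<^const>\<open>palm_measure\<close> becomes a
  statement about its values.\<close>
definition scaled_palm :: "'w measure" where
  "scaled_palm = distr (density kernel.joint (\<lambda>(\<omega>, x). ennreal (w x))) P (\<lambda>(\<omega>, x). \<theta> (- x) \<omega>)"

lemma sets_scaled_palm [measurable_cong, simp]: "sets scaled_palm = sets P" and space_scaled_palm [simp]: "space scaled_palm = space P"
  by (simp_all add: scaled_palm_def)

lemma nn_integral_scaled_palm:
  fixes f :: "_ \<Rightarrow> ennreal"
  assumes [measurable]: "f \<in> borel_measurable P"
  shows "(\<integral>\<^sup>+\<omega>. f \<omega> \<partial>scaled_palm) = (\<integral>\<^sup>+\<omega>. (\<integral>\<^sup>+x. f (\<theta> (- x) \<omega>) * ennreal (w x) \<partial>m \<omega>) \<partial>P)"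
proof -
  have "(\<integral>\<^sup>+\<omega>. f \<omega> \<partial>scaled_palm)
      = (\<integral>\<^sup>+z. f (case z of (\<omega>, x) \<Rightarrow> \<theta> (- x) \<omega>) \<partial>density kernel.joint (\<lambda>(\<omega>, x). ennreal (w x)))"
    unfolding scaled_palm_def by (rule nn_integral_distr) measurable
  also have "\<dots> = (\<integral>\<^sup>+z. (case z of (\<omega>, x) \<Rightarrow> ennreal (w x)) * f (case z of (\<omega>, x) \<Rightarrow> \<theta> (- x) \<omega>) \<partial>kernel.joint)"
    by (rule nn_integral_density) measurable
  also have "\<dots> = (\<integral>\<^sup>+\<omega>. (\<integral>\<^sup>+x. f (\<theta> (- x) \<omega>) * ennreal (w x) \<partial>m \<omega>) \<partial>P)"
  proof -
    have "(\<lambda>z. (case z of (\<omega>, x) \<Rightarrow> ennreal (w x)) * f (case z of (\<omega>, x) \<Rightarrow> \<theta> (- x) \<omega>))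
        \<in> borel_measurable (P \<Otimes>\<^sub>M borel)" by measurable
    from kernel.nn_integral_kernel_product[OF this] show ?thesis by (simp add: mult.commute)
  qed
  finally show ?thesis .
qed

lemma emeasure_scaled_palm:
  "A \<in> sets P \<Longrightarrow> emeasure scaled_palm A = (\<integral>\<^sup>+\<omega>. (\<integral>\<^sup>+x. indicator A (\<theta> (- x) \<omega>) * ennreal (w x) \<partial>m \<omega>) \<partial>P)"
  using nn_integral_scaled_palm[of "indicator A"] by simp

lemma palm_eq_scaled_palm: "palm_measure P \<theta> m \<gamma> w = scale_measure (ennreal (1 / \<gamma>)) scaled_palm"
proof -
  have "palm_measure P \<theta> m \<gamma> w
      = measure_of (space P) (sets P) (emeasure (scale_measure (ennreal (1 / \<gamma>)) scaled_palm))"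
    unfolding palm_measure_def
    by (intro measure_of_eq sets.space_closed) (simp add: sets.sigma_sets_eq emeasure_scaled_palm)
  also have "\<dots> = scale_measure (ennreal (1 / \<gamma>)) scaled_palm"
    using measure_of_of_measure[of "scale_measure (ennreal (1 / \<gamma>)) scaled_palm"]
    by (simp add: space_scale_measure)
  finally show ?thesis .
qed

text \<open>For fixed \<open>A\<close> the left side is a left-invariant \<open>\<sigma>\<close>-finite measure in \<open>B\<close>, hence a multiple of
  Haar measure; integrating the weight \<open>w\<close> shows that the factor is the mass of \<open>A\<close> under
  \<^const>\<open>scaled_palm\<close>.\<close>
lemma emeasure_campbell_rectangle:
  assumes A[measurable]: "A \<in> sets P" and B[measurable]: "B \<in> sets borel"
  shows "emeasure campbell (B \<times> A) = emeasure L B * emeasure scaled_palm A"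
proof -
  have campbell_rect: "emeasure campbell (B \<times> A) = (\<integral>\<^sup>+\<omega>. (\<integral>\<^sup>+x. indicator B x * indicator A (\<theta> (- x) \<omega>) \<partial>m \<omega>) \<partial>P)"
    if [measurable]: "B \<in> sets borel" for B
    by (subst emeasure_campbell) (simp_all add: indicator_times)
  \<comment> \<open>The Campbell measure of the position, restricted to views in \<open>A\<close>.\<close>
  define \<nu> where "\<nu> = distr (density campbell (\<lambda>(x, \<omega>). indicator A \<omega>)) borel fst"
  have [measurable_cong, simp]: "sets \<nu> = sets borel" by (simp add: \<nu>_def)
  have \<nu>_int: "(\<integral>\<^sup>+x. f x \<partial>\<nu>) = (\<integral>\<^sup>+(x, \<omega>). indicator A \<omega> * f x \<partial>campbell)"
    if [measurable]: "f \<in> borel_measurable borel" for f :: "'x \<Rightarrow> ennreal"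
  proof -
    have "(\<integral>\<^sup>+x. f x \<partial>\<nu>) = (\<integral>\<^sup>+z. f (fst z) \<partial>density campbell (\<lambda>(x, \<omega>). indicator A \<omega>))"
      unfolding \<nu>_def by (rule nn_integral_distr) measurable
    also have "\<dots> = (\<integral>\<^sup>+z. (case z of (x, \<omega>) \<Rightarrow> indicator A \<omega>) * f (fst z) \<partial>campbell)"
      by (rule nn_integral_density) measurable
    finally show ?thesis by (simp add: case_prod_unfold)
  qed
  have \<nu>: "emeasure \<nu> B = emeasure campbell (B \<times> A)" if [measurable]: "B \<in> sets borel" for B
  proof -
    have "emeasure \<nu> B = (\<integral>\<^sup>+(x, \<omega>). indicator A \<omega> * indicator B x \<partial>campbell)"
      using \<nu>_int[of "indicator B"] by simp
    also have "\<dots> = (\<integral>\<^sup>+z. indicator (B \<times> A) z \<partial>campbell)"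
      by (intro nn_integral_cong) (auto simp: indicator_times mult.commute)
    finally show ?thesis by simp
  qed
  have "sigma_finite_measure \<nu>"
  proof
    have "emeasure \<nu> (compact_cover i) \<noteq> \<infinity>" for i
    proof -
      have [measurable]: "compact_cover i \<in> sets borel" by (rule kernel.K_sets)
      have "emeasure \<nu> (compact_cover i) \<le> (\<integral>\<^sup>+\<omega>. emeasure (m \<omega>) (compact_cover i) \<partial>P)"
      proof (subst \<nu>[OF kernel.K_sets], subst campbell_rect[OF kernel.K_sets], rule nn_integral_mono)
        fix \<omega> assume "\<omega> \<in> space P"
        then have "emeasure (m \<omega>) (compact_cover i) = (\<integral>\<^sup>+x. indicator (compact_cover i) x \<partial>m \<omega>)"
          by (simp add: kernel.sets_kernel)
        then show "(\<integral>\<^sup>+x. indicator (compact_cover i) x * indicator A (\<theta> (- x) \<omega>) \<partial>m \<omega>) \<le> emeasure (m \<omega>) (compact_cover i)"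
          by (auto intro!: nn_integral_mono split: split_indicator)
      qed
      then show ?thesis using expected_count_compact_finite[OF compact_cover(1), of i] by auto
    qed
    then show "\<exists>F. countable F \<and> F \<subseteq> sets \<nu> \<and> \<Union> F = space \<nu> \<and> (\<forall>a\<in>F. emeasure \<nu> a \<noteq> \<infinity>)"
      using compact_cover(2) kernel.K_sets by (intro exI[of _ "range compact_cover"]) (auto simp: \<nu>_def)
  qed
  moreover have "distr \<nu> borel ((+) y) = \<nu>" for y
  proof (rule measure_eqI)
    fix B assume "B \<in> sets (distr \<nu> borel ((+) y))"
    then have B[measurable]: "B \<in> sets borel" by simp
    have "emeasure (distr \<nu> borel ((+) y)) B = (\<integral>\<^sup>+x. indicator B (y + x) \<partial>\<nu>)"
      using nn_integral_distr[of "(+) y" \<nu> borel "indicator B"] by simp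
    also have "\<dots> = (\<integral>\<^sup>+(x, \<omega>). indicator A \<omega> * indicator B (y + x) \<partial>campbell)"
      by (rule \<nu>_int) measurable
    also have "\<dots> = (\<integral>\<^sup>+(x, \<omega>). indicator A \<omega> * indicator B x \<partial>campbell)"
      using nn_integral_campbell_shift[of "\<lambda>(x, \<omega>). indicator A \<omega> * indicator B x" y] by simp
    also have "\<dots> = emeasure \<nu> B"
      using \<nu>_int[of "indicator B"] by simp
    finally show "emeasure (distr \<nu> borel ((+) y)) B = emeasure \<nu> B" .
  qed simp
  ultimately have "(\<integral>\<^sup>+x. indicator B x \<partial>\<nu>) = (\<integral>\<^sup>+x. ennreal (w x) \<partial>\<nu>) * (\<integral>\<^sup>+x. indicator B x \<partial>L)"
    by (intro left_invariant_measure_unique) (auto simp: weight_integral)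
  moreover have "(\<integral>\<^sup>+x. ennreal (w x) \<partial>\<nu>) = emeasure scaled_palm A"
  proof -
    have "(\<integral>\<^sup>+x. ennreal (w x) \<partial>\<nu>) = (\<integral>\<^sup>+(x, \<omega>). indicator A \<omega> * ennreal (w x) \<partial>campbell)"
      by (rule \<nu>_int) measurable
    also have "\<dots> = emeasure scaled_palm A"
    proof -
      have "(\<lambda>(x, \<omega>). indicator A \<omega> * ennreal (w x)) \<in> borel_measurable (borel \<Otimes>\<^sub>M P)" by measurable
      from nn_integral_campbell[OF this] show ?thesis by (simp add: emeasure_scaled_palm)
    qed
    finally show ?thesis .
  qed
  ultimately show ?thesis using \<nu>[OF B] by (simp add: mult.commute)
qed

lemma finite_scaled_palm: "finite_measure scaled_palm"
proof
  obtain B where B[measurable]: "B \<in> sets borel" and B2: "0 < emeasure L B" "emeasure L B < \<infinity>"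
    using positive_finite_set by blast
  have "emeasure L B * emeasure scaled_palm (space P) = emeasure campbell (B \<times> space P)"
    by (simp add: emeasure_campbell_rectangle)
  also have "\<dots> = (\<integral>\<^sup>+\<omega>. emeasure (m \<omega>) B \<partial>P)"
  proof -
    have "emeasure campbell (B \<times> space P) = (\<integral>\<^sup>+\<omega>. (\<integral>\<^sup>+x. indicator (B \<times> space P) (x, \<theta> (- x) \<omega>) \<partial>m \<omega>) \<partial>P)"
      by (rule emeasure_campbell) simp
    also have "\<dots> = (\<integral>\<^sup>+\<omega>. (\<integral>\<^sup>+x. indicator B x \<partial>m \<omega>) \<partial>P)"
      by (intro nn_integral_cong) (auto simp: flow_space split: split_indicator)
    also have "\<dots> = (\<integral>\<^sup>+\<omega>. emeasure (m \<omega>) B \<partial>P)"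
      by (intro nn_integral_cong nn_integral_indicator) (simp add: kernel.sets_kernel)
    finally show ?thesis .
  qed
  also have "\<dots> < \<infinity>"
    using B2 by (simp add: expected_count ennreal_mult_less_top)
  finally show "emeasure scaled_palm (space scaled_palm) \<noteq> \<infinity>"
    using B2 by (auto simp: ennreal_mult_less_top ennreal_mult_top)
qed

sublocale scaled_palm: finite_measure scaled_palm by (rule finite_scaled_palm)

lemma campbell_eq_product: "campbell = L \<Otimes>\<^sub>M scaled_palm"
proof (rule pair_measure_eqI[symmetric])
  show "sets (L \<Otimes>\<^sub>M scaled_palm) = sets campbell" by (simp cong: sets_pair_measure_cong)
  show "emeasure L A * emeasure scaled_palm B = emeasure campbell (A \<times> B)" if "A \<in> sets L" "B \<in> sets scaled_palm" for A B
    using that by (simp add: emeasure_campbell_rectangle)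
qed (rule haar.sigma_finite_measure_axioms scaled_palm.sigma_finite_measure_axioms)+

text \<open>The refined Campbell theorem, with the intensity absorbed in \<^const>\<open>scaled_palm\<close>.\<close>
lemma refined_campbell:
  fixes f :: "_ \<Rightarrow> ennreal"
  assumes f[measurable]: "f \<in> borel_measurable (borel \<Otimes>\<^sub>M P)"
  shows "(\<integral>\<^sup>+\<omega>. (\<integral>\<^sup>+x. f (x, \<theta> (- x) \<omega>) \<partial>m \<omega>) \<partial>P) = (\<integral>\<^sup>+\<omega>. (\<integral>\<^sup>+x. f (x, \<omega>) \<partial>L) \<partial>scaled_palm)"
proof -
  interpret pair_sigma_finite L scaled_palm ..
  have "(\<integral>\<^sup>+\<omega>. (\<integral>\<^sup>+x. f (x, \<theta> (- x) \<omega>) \<partial>m \<omega>) \<partial>P) = (\<integral>\<^sup>+z. f z \<partial>(L \<Otimes>\<^sub>M scaled_palm))"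
    by (simp add: nn_integral_campbell[symmetric] campbell_eq_product)
  also have "\<dots> = (\<integral>\<^sup>+\<omega>. (\<integral>\<^sup>+x. f (x, \<omega>) \<partial>L) \<partial>scaled_palm)"
    by (rule nn_integral_snd[symmetric]) measurable
  finally show ?thesis .
qed

end

section \<open>Bijective point-shifts\<close>

locale bijective_point_shift = stationary_point_process L \<Delta> P \<theta> m \<gamma> w
  for L :: "'x::{topological_group_add, second_countable_topology, t2_space} measure"
    and \<Delta> and P :: "'w measure" and \<theta> :: "'x \<Rightarrow> 'w \<Rightarrow> 'w" and m \<gamma> w +
  fixes H :: "'w \<Rightarrow> 'x \<Rightarrow> 'x"
  assumes shift: "point_shift P \<theta> m H"
    and bijective: "bijective_shift P m H"
begin

lemma H_measurable_pair: "(\<lambda>(\<omega>, x). H \<omega> x) \<in> P \<Otimes>\<^sub>M borel \<rightarrow>\<^sub>M borel"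
  using shift by (simp add: point_shift_def)

lemma H_measurable [measurable (raw)]:
  assumes "f \<in> N \<rightarrow>\<^sub>M P" "g \<in> borel_measurable N"
  shows "(\<lambda>z. H (f z) (g z)) \<in> borel_measurable N"
  using measurable_compose[OF measurable_Pair[OF assms] H_measurable_pair] by simp

lemma H_flow: "\<omega> \<in> space P \<Longrightarrow> H (\<theta> y \<omega>) (y + x) = y + H \<omega> x"
  using shift by (simp add: point_shift_def)

abbreviation h where "h \<equiv> point_map H"
abbreviation h' where "h' \<equiv> point_map_minus m H"

lemma h_measurable [measurable]: "h \<in> borel_measurable P"
  unfolding point_map_def by measurable

lemma h_flow: "\<omega> \<in> space P \<Longrightarrow> h (\<theta> (- x) \<omega>) = - x + H \<omega> x"
  using H_flow[of \<omega> "- x" x] by (simp add: point_map_def)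

text \<open>Existence and uniqueness of a point in a set mean mass one, so \<^term>\<open>h'\<close> is measurable
  because masses of sections are.\<close>
lemma h'_measurable [measurable]: "h' \<in> borel_measurable P"
proof (rule measurableI)
  fix B :: "'x set" assume B[measurable]: "B \<in> sets borel"
  \<comment> \<open>The number of preimages of the origin in \<open>B\<close>.\<close>
  define N where "N B \<omega> = emeasure (m \<omega>) (Pair \<omega> -` {z\<in>space (P \<Otimes>\<^sub>M borel). snd z \<in> B \<and> H (fst z) (snd z) = 0})"
    for B \<omega>
  have N[measurable]: "N B \<in> borel_measurable P" if [measurable]: "B \<in> sets borel" for B
    unfolding N_def by (rule kernel.section_emeasure_measurable) measurable
  have N1: "N B \<omega> = 1 \<longleftrightarrow> (\<exists>!Y. Y \<in> points (m \<omega>) \<and> Y \<in> B \<and> H \<omega> Y = 0)"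
    if \<omega>[measurable]: "\<omega> \<in> space P" and [measurable]: "B \<in> sets borel" for \<omega> B
  proof -
    interpret simple_counting_measure "m \<omega>" using simple_counting[OF \<omega>] .
    have "{x. x \<in> B \<and> H \<omega> x = 0} \<in> sets borel" by measurable
    from emeasure_eq_1_iff[OF this] show ?thesis
      using \<omega> by (simp add: N_def vimage_def space_pair_measure)
  qed
  have preimage: "h' \<omega> \<in> B \<longleftrightarrow> (if N UNIV \<omega> = 1 then N B \<omega> = 1 else 0 \<in> B)" if \<omega>: "\<omega> \<in> space P" for \<omega>
  proof (cases "N UNIV \<omega> = 1")
    case True
    then have ex: "\<exists>!Y. Y \<in> points (m \<omega>) \<and> H \<omega> Y = 0" using N1[OF \<omega>, of UNIV] by simp
    then have "h' \<omega> \<in> points (m \<omega>) \<and> H \<omega> (h' \<omega>) = 0"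
      unfolding point_map_minus_def using theI'[OF ex] by simp
    then show ?thesis using True ex N1[OF \<omega> B] by auto
  next
    case False
    then have "h' \<omega> = 0" using N1[OF \<omega>, of UNIV] by (simp add: point_map_minus_def)
    then show ?thesis using False by simp
  qed
  have "h' -` B \<inter> space P = {\<omega>\<in>space P. if N UNIV \<omega> = 1 then N B \<omega> = 1 else 0 \<in> B}"
    using preimage by auto
  also have "\<dots> \<in> sets P" by measurable
  finally show "h' -` B \<inter> space P \<in> sets P" .
qed simp

text \<open>The shift commutes with the flow, so the preimages of the origin in the view from \<open>H \<omega> y\<close> are
  the translates of the preimages of \<open>H \<omega> y\<close>, and injectivity leaves only \<open>y\<close>.\<close>
lemma h'_flow:
  assumes \<omega>: "\<omega> \<in> space P" and bij: "bij_betw (H \<omega>) (points (m \<omega>)) (points (m \<omega>))"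
    and y: "y \<in> points (m \<omega>)"
  shows "h' (\<theta> (- H \<omega> y) \<omega>) = - H \<omega> y + y"
proof -
  let ?z = "H \<omega> y"
  have "Y \<in> points (m (\<theta> (- ?z) \<omega>)) \<and> H (\<theta> (- ?z) \<omega>) Y = 0 \<longleftrightarrow> Y = - ?z + y" for Y
  proof
    assume "Y \<in> points (m (\<theta> (- ?z) \<omega>)) \<and> H (\<theta> (- ?z) \<omega>) Y = 0"
    then obtain x where x: "x \<in> points (m \<omega>)" "Y = - ?z + x" "H (\<theta> (- ?z) \<omega>) (- ?z + x) = 0"
      by (auto simp: points_shift[OF \<omega>])
    then have "H \<omega> x = ?z" using H_flow[OF \<omega>, of "- ?z" x]
      by (metis add.inverse_inverse add_eq_0_iff)
    then show "Y = - ?z + y" using x(1,2) y bij by (auto simp: bij_betw_def inj_on_def)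
  next
    assume "Y = - ?z + y"
    then show "Y \<in> points (m (\<theta> (- ?z) \<omega>)) \<and> H (\<theta> (- ?z) \<omega>) Y = 0"
      using y H_flow[OF \<omega>, of "- ?z" y] by (simp add: points_shift[OF \<omega>])
  qed
  then show ?thesis by (simp add: point_map_minus_def)
qed

text \<open>The heart of the proof. The weight is attached to a point \<open>x\<close>; writing \<open>x = H \<omega> y\<close> moves the
  centre of observation to the preimage \<open>y\<close>, from where \<open>x\<close> is seen at \<open>h\<close>, so that the preimage
  seen from \<open>x\<close> becomes \<open>- h\<close>. The weight is then evaluated at \<open>y + h\<close>, and integrating out
  the location \<open>y\<close> of the centre against left Haar measure yields the factor \<open>\<Delta> (- h)\<close>.\<close>
lemma law_h':
  "distr scaled_palm borel h' = density (distr scaled_palm borel (\<lambda>\<omega>. - h \<omega>)) (\<lambda>x. ennreal (\<Delta> x))"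
proof (rule measure_eqI)
  fix B assume "B \<in> sets (distr scaled_palm borel h')"
  then have B[measurable]: "B \<in> sets borel" by simp
  have "emeasure (distr scaled_palm borel h') B = (\<integral>\<^sup>+\<omega>. indicator B (h' \<omega>) \<partial>scaled_palm)"
    using nn_integral_distr[of h' scaled_palm borel "indicator B"] by simp
  also have "\<dots> = (\<integral>\<^sup>+\<omega>. (\<integral>\<^sup>+x. indicator B (h' (\<theta> (- x) \<omega>)) * ennreal (w x) \<partial>m \<omega>) \<partial>P)"
    by (rule nn_integral_scaled_palm) measurable
  \<comment> \<open>Reindexing the points by their preimages.\<close>
  also have "\<dots> = (\<integral>\<^sup>+\<omega>. (\<integral>\<^sup>+y. indicator B (- H \<omega> y + y) * ennreal (w (H \<omega> y)) \<partial>m \<omega>) \<partial>P)"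
  proof (rule nn_integral_cong_AE)
    show "AE \<omega> in P. (\<integral>\<^sup>+x. indicator B (h' (\<theta> (- x) \<omega>)) * ennreal (w x) \<partial>m \<omega>)
        = (\<integral>\<^sup>+y. indicator B (- H \<omega> y + y) * ennreal (w (H \<omega> y)) \<partial>m \<omega>)"
      using bijective[unfolded bijective_shift_def]
    proof (rule AE_mp, intro AE_I2 impI)
      fix \<omega> assume \<omega>[measurable]: "\<omega> \<in> space P" and bij: "bij_betw (H \<omega>) (points (m \<omega>)) (points (m \<omega>))"
      interpret simple_counting_measure "m \<omega>" using simple_counting[OF \<omega>] .
      have "(\<integral>\<^sup>+x. indicator B (h' (\<theta> (- x) \<omega>)) * ennreal (w x) \<partial>m \<omega>)
          = (\<integral>\<^sup>+x. indicator B (h' (\<theta> (- x) \<omega>)) * ennreal (w x) \<partial>distr (m \<omega>) borel (H \<omega>))"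
        by (subst distr_bij_points[OF _ bij]) auto
      also have "\<dots> = (\<integral>\<^sup>+y. indicator B (h' (\<theta> (- H \<omega> y) \<omega>)) * ennreal (w (H \<omega> y)) \<partial>m \<omega>)"
        by (rule nn_integral_distr) measurable
      also have "\<dots> = (\<integral>\<^sup>+y. indicator B (- H \<omega> y + y) * ennreal (w (H \<omega> y)) \<partial>m \<omega>)"
        by (rule nn_integral_cong_AE) (use AE_points in eventually_elim, simp add: h'_flow[OF \<omega> bij])
      finally show "(\<integral>\<^sup>+x. indicator B (h' (\<theta> (- x) \<omega>)) * ennreal (w x) \<partial>m \<omega>)
        = (\<integral>\<^sup>+y. indicator B (- H \<omega> y + y) * ennreal (w (H \<omega> y)) \<partial>m \<omega>)" .
    qed
  qed
  \<comment> \<open>The integrand now depends only on \<open>y\<close> and on the view from \<open>y\<close>, as the refined Campbell theorem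
      requires.\<close>
  also have "\<dots> = (\<integral>\<^sup>+\<omega>. (\<integral>\<^sup>+y. indicator B (- h (\<theta> (- y) \<omega>)) * ennreal (w (y + h (\<theta> (- y) \<omega>))) \<partial>m \<omega>) \<partial>P)"
    by (intro nn_integral_cong) (simp add: h_flow minus_add add.assoc[symmetric])
  also have "\<dots> = (\<integral>\<^sup>+\<omega>. (\<integral>\<^sup>+x. indicator B (- h \<omega>) * ennreal (w (x + h \<omega>)) \<partial>L) \<partial>scaled_palm)"
    using refined_campbell[of "\<lambda>(x, \<omega>). indicator B (- h \<omega>) * ennreal (w (x + h \<omega>))"] by simp
  also have "\<dots> = (\<integral>\<^sup>+\<omega>. ennreal (\<Delta> (- h \<omega>)) * indicator B (- h \<omega>) \<partial>scaled_palm)"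
    by (intro nn_integral_cong)
      (simp add: nn_integral_cmult nn_integral_right_translate[of "\<lambda>x. ennreal (w x)"] weight_integral mult.commute)
  also have "\<dots> = (\<integral>\<^sup>+x. ennreal (\<Delta> x) * indicator B x \<partial>distr scaled_palm borel (\<lambda>\<omega>. - h \<omega>))"
    by (rule nn_integral_distr[symmetric]) measurable
  also have "\<dots> = emeasure (density (distr scaled_palm borel (\<lambda>\<omega>. - h \<omega>)) (\<lambda>x. ennreal (\<Delta> x))) B"
    by (rule emeasure_density[symmetric]) auto
  finally show "emeasure (distr scaled_palm borel h') B
      = emeasure (density (distr scaled_palm borel (\<lambda>\<omega>. - h \<omega>)) (\<lambda>x. ennreal (\<Delta> x))) B" .
qed simp

text \<open>Densities with respect to a finite measure are determined almost everywhere, and the law of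
  \<open>- h\<close> has density one with respect to itself.\<close>
lemma same_law_scaled_palm_iff:
  "distr scaled_palm borel (\<lambda>\<omega>. - h \<omega>) = distr scaled_palm borel h' \<longleftrightarrow> (AE \<omega> in scaled_palm. \<Delta> (- h \<omega>) = 1)"
proof -
  let ?\<mu> = "distr scaled_palm borel (\<lambda>\<omega>. - h \<omega>)"
  interpret \<mu>: finite_measure ?\<mu> by (rule scaled_palm.finite_measure_distr) measurable
  have "?\<mu> = distr scaled_palm borel h' \<longleftrightarrow> density ?\<mu> (\<lambda>x. 1) = density ?\<mu> (\<lambda>x. ennreal (\<Delta> x))"
    by (simp add: law_h' density_1)
  also have "\<dots> \<longleftrightarrow> (AE x in ?\<mu>. 1 = ennreal (\<Delta> x))"
    by (rule \<mu>.density_unique_iff) auto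
  also have "\<dots> \<longleftrightarrow> (AE x in ?\<mu>. \<Delta> x = 1)"
    by (intro AE_cong) (auto simp: ennreal_eq_1)
  also have "\<dots> \<longleftrightarrow> (AE \<omega> in scaled_palm. \<Delta> (- h \<omega>) = 1)"
    by (rule AE_distr_iff) measurable
  finally show ?thesis .
qed

text \<open>Passing from the typical point to all points: a set of realizations is null for
  \<^const>\<open>scaled_palm\<close> iff its product with the whole group is null for the Campbell measure,
  because Haar measure is nonzero; and the latter means that almost surely no point sees the
  set. The view from \<open>x\<close> has \<open>\<Delta> (- h) = 1\<close> iff \<open>\<Delta>\<close> agrees at \<open>x\<close> and \<open>H \<omega> x\<close>.\<close>
lemma AE_modular_iff_isomodular:
  "(AE \<omega> in scaled_palm. \<Delta> (- h \<omega>) = 1) \<longleftrightarrow> isomodular P m \<Delta> H"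
proof -
  define N where "N = {\<omega>\<in>space P. \<Delta> (- h \<omega>) \<noteq> 1}"
  have [measurable]: "N \<in> sets P" unfolding N_def by measurable
  have "(AE \<omega> in scaled_palm. \<Delta> (- h \<omega>) = 1) \<longleftrightarrow> emeasure scaled_palm N = 0"
    by (subst AE_iff_measurable[of N]) (auto simp: N_def)
  also have "\<dots> \<longleftrightarrow> emeasure campbell (UNIV \<times> N) = 0"
    using haar_nonzero by (simp add: emeasure_campbell_rectangle)
  also have "emeasure campbell (UNIV \<times> N) = (\<integral>\<^sup>+\<omega>. (\<integral>\<^sup>+x. indicator N (\<theta> (- x) \<omega>) \<partial>m \<omega>) \<partial>P)"
    by (subst emeasure_campbell) (simp_all add: indicator_times)
  also have "\<dots> = 0 \<longleftrightarrow> (AE \<omega> in P. (\<integral>\<^sup>+x. indicator N (\<theta> (- x) \<omega>) \<partial>m \<omega>) = 0)"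
    using kernel.nn_integral_kernel_measurable[of "\<lambda>(\<omega>, x). indicator N (\<theta> (- x) \<omega>)"]
    by (intro nn_integral_0_iff_AE) simp
  also have "\<dots> \<longleftrightarrow> (AE \<omega> in P. \<forall>X\<in>points (m \<omega>). \<Delta> X = \<Delta> (H \<omega> X))"
  proof (rule AE_cong)
    fix \<omega> assume \<omega>[measurable]: "\<omega> \<in> space P"
    interpret simple_counting_measure "m \<omega>" using simple_counting[OF \<omega>] .
    have D: "{x. \<Delta> x \<noteq> \<Delta> (H \<omega> x)} \<in> sets borel" by measurable
    have "\<theta> (- x) \<omega> \<in> N \<longleftrightarrow> \<Delta> x \<noteq> \<Delta> (H \<omega> x)" for x
      using modular_diff_eq_1_iff[of "H \<omega> x" x] \<omega>
      by (auto simp: N_def flow_space h_flow minus_add)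
    then have "(\<integral>\<^sup>+x. indicator N (\<theta> (- x) \<omega>) \<partial>m \<omega>) = (\<integral>\<^sup>+x. indicator {x. \<Delta> x \<noteq> \<Delta> (H \<omega> x)} x \<partial>m \<omega>)"
      by (intro nn_integral_cong) (simp split: split_indicator)
    also have "\<dots> = emeasure (m \<omega>) {x. \<Delta> x \<noteq> \<Delta> (H \<omega> x)}"
      using D by (intro nn_integral_indicator) simp
    finally show "(\<integral>\<^sup>+x. indicator N (\<theta> (- x) \<omega>) \<partial>m \<omega>) = 0 \<longleftrightarrow> (\<forall>X\<in>points (m \<omega>). \<Delta> X = \<Delta> (H \<omega> X))"
      by (auto simp: emeasure_eq_0_iff[OF D])
  qed
  finally show ?thesis by (simp add: isomodular_def)
qed

lemma same_law_palm_iff: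
  "distr (palm_measure P \<theta> m \<gamma> w) borel (\<lambda>\<omega>. - h \<omega>) = distr (palm_measure P \<theta> m \<gamma> w) borel h'
    \<longleftrightarrow> distr scaled_palm borel (\<lambda>\<omega>. - h \<omega>) = distr scaled_palm borel h'"
proof -
  have palm: "emeasure (distr (palm_measure P \<theta> m \<gamma> w) borel f) B
      = ennreal (1 / \<gamma>) * emeasure (distr scaled_palm borel f) B"
    if [measurable]: "f \<in> borel_measurable P" "B \<in> sets borel" for f :: "'w \<Rightarrow> 'x" and B
    unfolding palm_eq_scaled_palm by (simp add: emeasure_distr space_scale_measure cong: measurable_cong_sets)
  have "M = N \<longleftrightarrow> (\<forall>B\<in>sets borel. emeasure M B = emeasure N B)"
    if "sets M = sets borel" "sets N = sets borel" for M N :: "'x measure"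
    using that by (auto intro: measure_eqI)
  then show ?thesis
    using intensity_pos by (simp add: palm ennreal_mult_cancel_left)
qed

end

theorem theorem4p9:
  fixes L :: "'x::{topological_group_add, second_countable_topology, t2_space} measure"
    and \<Delta> :: "'x \<Rightarrow> real"
    and P :: "'w measure"
    and \<theta> :: "'x \<Rightarrow> 'w \<Rightarrow> 'w"
    and m :: "'w \<Rightarrow> 'x measure"
    and \<gamma> :: real
    and w :: "'x \<Rightarrow> real"
    and H :: "'w \<Rightarrow> 'x \<Rightarrow> 'x"
  assumes "locally_compact_space (euclidean :: 'x topology)"
    and "left_haar_measure L"
    and "is_modular_function L \<Delta>"
    and "stationary_framework P \<theta>"
    and "simple_point_process P m"
    and "flow_adapted P \<theta> m"
    and "0 < \<gamma>"
    and "has_intensity L P m \<gamma>"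
    and "w \<in> borel_measurable borel"
    and "\<And>x. 0 \<le> w x"
    and "(\<integral>\<^sup>+x. ennreal (w x) \<partial>L) = 1"
    and "point_shift P \<theta> m H"
    and "bijective_shift P m H"
  shows "distr (palm_measure P \<theta> m \<gamma> w) borel (\<lambda>\<omega>. - point_map H \<omega>)
           = distr (palm_measure P \<theta> m \<gamma> w) borel (point_map_minus m H)
         \<longleftrightarrow> isomodular P m \<Delta> H"
proof -
  interpret bijective_point_shift L \<Delta> P \<theta> m \<gamma> w H
    using assms by (intro bijective_point_shift.intro stationary_point_process.intro haar_group.intro
      stationary_point_process_axioms.intro bijective_point_shift_axioms.intro)
  show ?thesis
    using same_law_palm_iff same_law_scaled_palm_iff AE_modular_iff_isomodular by blast
qed

end
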